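(* Let $A > B > C$ be a skew chain (the skew lattice $A\cup B\cup C$ with exactly these three $\mathcal D$-classes). The following conditions are equivalent: (i) $A > B > C$ is distributive. (ii) For all $a \in A$, $b \in B$ and $c \in C$ with $a > c$, $a\wedge (c\vee b\vee c)\wedge a = c\vee (a\wedge b\wedge a)\vee c$. (iii) Given $a \in A$ and $c \in C$ with $a > c$, each $AC$-component $B'$ of $B$ contains a unique midpoint $b$ of $a$ and $c$. (iv) For each $AC$-component $B'$ of $B$, the skew chain $A>B'>C$ is strictly categorical. When these conditions hold, each coset bijection $\chi: A \rightarrow C$ factors uniquely through each $AC$-component $B'$ of $B$, in that unique coset bijections $\varphi: A \rightarrow B'$ and $\psi: B' \rightarrow C$ (of the skew chain $A>B'>C$) exist such that $\chi = \psi \circ \varphi$ under the usual composition of partial bijections.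
   Context: A skew lattice is a set $S$ with two associative, idempotent binary operations $\wedge,\vee$ satisfying $x\wedge (x\vee y) = x = (y\vee x)\wedge x$ and $x\vee (x\wedge y) = x = (y\wedge x)\vee x$. It is distributive if it satisfies both $x\wedge (y\vee z)\wedge x = (x\wedge y\wedge x)\vee (x\wedge z\wedge x)$ and $x\vee (y\wedge z)\vee x = (x\vee y\vee x)\wedge (x\vee z\vee x)$. Natural preorder: $a\succeq b$ iff $a\vee b\vee a=a$ (equivalently $b\wedge a\wedge b=b$). Natural partial order: $x\ge y$ iff $x\wedge y=y=y\wedge x$ (equivalently $x\vee y=x=y\vee x$); $x>y$ means $x\ge y$ and $x\ne y$. The relation $a\mathrel{\mathcal D}b$ iff $a\succeq b$ and $b\succeq a$ is a congruence, and $S/\mathcal D$ is a lattice; for $\mathcal D$-classes, $A\ge B$ means $a\succeq b$ for $a\in A$, $b\in B$. A skew chain $A>B>C$ consists of $\mathcal D$-classes that are strictly decreasing in this order; its union is a subalgebra, regarded as a skew lattice. For $\mathcal D$-classes $A>B$: an $A$-coset in $B$ is a set $A\wedge b\wedge A=\{a\wedge b\wedge a'\mid a,a'\in A\}$ with $b\in B$; a $B$-coset in $A$ is a set $B\vee a\vee B=\{b\vee a\vee b'\mid b,b'\in B\}$ with $a\in A$. The $A$-cosets partition $B$ and the $B$-cosets partition $A$. For a $B$-coset $X$ in $A$ and an $A$-coset $Y$ in $B$, the coset bijection $\varphi:X\to Y$ is given by $\varphi(a)=b$ iff $a\in X$, $b\in Y$, $a>b$; it is regarded as a partial bijection $\varphi:A\to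 B$ with domain $X$ and range $Y$. In a skew chain $A>B>C$: a midpoint in $B$ of $a\in A$ and $c\in C$ (where $a>c$) is an element $b\in B$ with $a>b>c$. Elements $b,b'\in B$ are $AC$-connected if there is a finite sequence $b=b_0,b_1,\dots,b_n=b'$ in $B$ such that for each $i\le n-1$, $b_i$ and $b_{i+1}$ lie in a common $A$-coset in $B$ or in a common $C$-coset in $B$. A maximal $AC$-connected subset of $B$ is an $AC$-component of $B$. Each $AC$-component $B'$ is a subalgebra, and $A>B'>C$ is again a skew chain (a sub-skew chain). A skew lattice is categorical if for all skew chains $A>B>C$ of $\mathcal D$-classes in it, every nonempty composite $\psi\circ\varphi$ of coset bijections $\varphi$ from $A$ to $B$ and $\psi$ from $B$ to $C$ is a coset bijection from $A$ to $C$. It is strictly categorical if in addition, for every chain of $\mathcal D$-classes $A>B>C$, each $A$-coset in $B$ has nonempty intersection with each $C$-coset in $B$. *)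

theory Defs
  imports Main
begin

text \<open>
  Skew lattices are given by a carrier set and two operations, because the union of a family of
  \<open>\<D>\<close>-classes has to be regarded as a skew lattice in its own right.
\<close>

locale skew_lattice =
  fixes S :: "'a set"
    and meet :: "'a \<Rightarrow> 'a \<Rightarrow> 'a" (infixl "\<sqinter>" 70)
    and join :: "'a \<Rightarrow> 'a \<Rightarrow> 'a" (infixl "\<squnion>" 65)
  assumes meet_closed: "\<lbrakk>x \<in> S; y \<in> S\<rbrakk> \<Longrightarrow> x \<sqinter> y \<in> S"
    and join_closed: "\<lbrakk>x \<in> S; y \<in> S\<rbrakk> \<Longrightarrow> x \<squnion> y \<in> S"
    and meet_assoc: "\<lbrakk>x \<in> S; y \<in> S; z \<in> S\<rbrakk> \<Longrightarrow> (x \<sqinter> y) \<sqinter> z = x \<sqinter> (y \<sqinter> z)"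
    and join_assoc: "\<lbrakk>x \<in> S; y \<in> S; z \<in> S\<rbrakk> \<Longrightarrow> (x \<squnion> y) \<squnion> z = x \<squnion> (y \<squnion> z)"
    and meet_idem: "x \<in> S \<Longrightarrow> x \<sqinter> x = x"
    and join_idem: "x \<in> S \<Longrightarrow> x \<squnion> x = x"
    and meet_join_absorb: "\<lbrakk>x \<in> S; y \<in> S\<rbrakk> \<Longrightarrow> x \<sqinter> (x \<squnion> y) = x"
    and join_meet_absorb_right: "\<lbrakk>x \<in> S; y \<in> S\<rbrakk> \<Longrightarrow> (y \<squnion> x) \<sqinter> x = x"
    and join_meet_absorb: "\<lbrakk>x \<in> S; y \<in> S\<rbrakk> \<Longrightarrow> x \<squnion> (x \<sqinter> y) = x"
    and meet_join_absorb_right: "\<lbrakk>x \<in> S; y \<in> S\<rbrakk> \<Longrightarrow> (y \<sqinter> x) \<squnion> x = x"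

locale distributive_skew_lattice = skew_lattice +
  assumes meet_distrib: "\<lbrakk>x \<in> S; y \<in> S; z \<in> S\<rbrakk> \<Longrightarrow>
      x \<sqinter> (y \<squnion> z) \<sqinter> x = (x \<sqinter> y \<sqinter> x) \<squnion> (x \<sqinter> z \<sqinter> x)"
    and join_distrib: "\<lbrakk>x \<in> S; y \<in> S; z \<in> S\<rbrakk> \<Longrightarrow>
      x \<squnion> (y \<sqinter> z) \<squnion> x = (x \<squnion> y \<squnion> x) \<sqinter> (x \<squnion> z \<squnion> x)"

definition preorder_ge :: "('a \<Rightarrow> 'a \<Rightarrow> 'a) \<Rightarrow> 'a \<Rightarrow> 'a \<Rightarrow> bool" where
  "preorder_ge join a b \<longleftrightarrow> join (join a b) a = a"

definition natural_ge :: "('a \<Rightarrow> 'a \<Rightarrow> 'a) \<Rightarrow> 'a \<Rightarrow> 'a \<Rightarrow> bool" where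
  "natural_ge meet x y \<longleftrightarrow> meet x y = y \<and> meet y x = y"

definition natural_gt :: "('a \<Rightarrow> 'a \<Rightarrow> 'a) \<Rightarrow> 'a \<Rightarrow> 'a \<Rightarrow> bool" where
  "natural_gt meet x y \<longleftrightarrow> natural_ge meet x y \<and> x \<noteq> y"

definition D_rel :: "'a set \<Rightarrow> ('a \<Rightarrow> 'a \<Rightarrow> 'a) \<Rightarrow> 'a rel" where
  "D_rel S join = {(a, b). a \<in> S \<and> b \<in> S \<and> preorder_ge join a b \<and> preorder_ge join b a}"

definition D_classes :: "'a set \<Rightarrow> ('a \<Rightarrow> 'a \<Rightarrow> 'a) \<Rightarrow> 'a set set" where
  "D_classes S join = S // D_rel S join"

definition class_gt :: "('a \<Rightarrow> 'a \<Rightarrow> 'a) \<Rightarrow> 'a set \<Rightarrow> 'a set \<Rightarrow> bool" where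
  "class_gt join A B \<longleftrightarrow> (\<forall>a\<in>A. \<forall>b\<in>B. preorder_ge join a b) \<and> A \<noteq> B"

locale skew_chain =
  skew_lattice "A \<union> B \<union> C" meet join
  for A B C :: "'a set" and meet join :: "'a \<Rightarrow> 'a \<Rightarrow> 'a" +
  assumes classes: "D_classes (A \<union> B \<union> C) join = {A, B, C}"
    and A_gt_B: "class_gt join A B"
    and B_gt_C: "class_gt join B C"

text \<open>
  For classes \<open>A > B\<close>, \<open>meet_cosets meet A B\<close> is the set of \<open>A\<close>-cosets in \<open>B\<close> and
  \<open>join_cosets join B A\<close> is the set of \<open>B\<close>-cosets in \<open>A\<close>.
\<close>

definition meet_coset :: "('a \<Rightarrow> 'a \<Rightarrow> 'a) \<Rightarrow> 'a set \<Rightarrow> 'a \<Rightarrow> 'a set" where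
  "meet_coset meet A b = {meet (meet a b) a' | a a'. a \<in> A \<and> a' \<in> A}"

definition meet_cosets :: "('a \<Rightarrow> 'a \<Rightarrow> 'a) \<Rightarrow> 'a set \<Rightarrow> 'a set \<Rightarrow> 'a set set" where
  "meet_cosets meet A B = meet_coset meet A ` B"

definition join_coset :: "('a \<Rightarrow> 'a \<Rightarrow> 'a) \<Rightarrow> 'a set \<Rightarrow> 'a \<Rightarrow> 'a set" where
  "join_coset join B a = {join (join b a) b' | b b'. b \<in> B \<and> b' \<in> B}"

definition join_cosets :: "('a \<Rightarrow> 'a \<Rightarrow> 'a) \<Rightarrow> 'a set \<Rightarrow> 'a set \<Rightarrow> 'a set set" where
  "join_cosets join B A = join_coset join B ` A"

text \<open>
  Coset bijections are partial maps, so that they compose with \<^term>\<open>map_comp\<close>. For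
  \<open>\<D>\<close>-classes \<open>A > B\<close> of a skew lattice, the last conjunct determines the map and implies
  the other three.
\<close>

definition coset_bijection ::
  "('a \<Rightarrow> 'a \<Rightarrow> 'a) \<Rightarrow> ('a \<Rightarrow> 'a \<Rightarrow> 'a) \<Rightarrow> 'a set \<Rightarrow> 'a set \<Rightarrow> ('a \<rightharpoonup> 'a) \<Rightarrow> bool" where
  "coset_bijection meet join A B \<phi> \<longleftrightarrow>
    (\<exists>X \<in> join_cosets join B A. \<exists>Y \<in> meet_cosets meet A B.
      dom \<phi> = X \<and> ran \<phi> = Y \<and> inj_on \<phi> X \<and>
      (\<forall>a b. \<phi> a = Some b \<longleftrightarrow> a \<in> X \<and> b \<in> Y \<and> natural_gt meet a b))"

locale categorical_skew_lattice = skew_lattice +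
  assumes comp_coset_bijection:
    "\<lbrakk>A \<in> D_classes S join; B \<in> D_classes S join; C \<in> D_classes S join;
      class_gt join A B; class_gt join B C;
      coset_bijection meet join A B \<phi>; coset_bijection meet join B C \<psi>;
      \<psi> \<circ>\<^sub>m \<phi> \<noteq> Map.empty\<rbrakk>
     \<Longrightarrow> coset_bijection meet join A C (\<psi> \<circ>\<^sub>m \<phi>)"

locale strictly_categorical_skew_lattice = categorical_skew_lattice +
  assumes cosets_meet:
    "\<lbrakk>A \<in> D_classes S join; B \<in> D_classes S join; C \<in> D_classes S join;
      class_gt join A B; class_gt join B C;
      X \<in> meet_cosets meet A B; Y \<in> join_cosets join C B\<rbrakk>
     \<Longrightarrow> X \<inter> Y \<noteq> {}"

definition midpoint :: "('a \<Rightarrow> 'a \<Rightarrow> 'a) \<Rightarrow> 'a set \<Rightarrow> 'a \<Rightarrow> 'a \<Rightarrow> 'a \<Rightarrow> bool" where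
  "midpoint meet B a c b \<longleftrightarrow> b \<in> B \<and> natural_gt meet a b \<and> natural_gt meet b c"

definition AC_step ::
  "('a \<Rightarrow> 'a \<Rightarrow> 'a) \<Rightarrow> ('a \<Rightarrow> 'a \<Rightarrow> 'a) \<Rightarrow> 'a set \<Rightarrow> 'a set \<Rightarrow> 'a set \<Rightarrow> 'a rel" where
  "AC_step meet join A B C =
    {(b, b'). b \<in> B \<and> b' \<in> B \<and>
      (\<exists>X \<in> meet_cosets meet A B \<union> join_cosets join C B. b \<in> X \<and> b' \<in> X)}"

definition AC_connected ::
  "('a \<Rightarrow> 'a \<Rightarrow> 'a) \<Rightarrow> ('a \<Rightarrow> 'a \<Rightarrow> 'a) \<Rightarrow> 'a set \<Rightarrow> 'a set \<Rightarrow> 'a set \<Rightarrow> 'a \<Rightarrow> 'a \<Rightarrow> bool" where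
  "AC_connected meet join A B C b b' \<longleftrightarrow>
    b \<in> B \<and> b' \<in> B \<and> (b, b') \<in> (AC_step meet join A B C)\<^sup>*"

definition AC_connected_set ::
  "('a \<Rightarrow> 'a \<Rightarrow> 'a) \<Rightarrow> ('a \<Rightarrow> 'a \<Rightarrow> 'a) \<Rightarrow> 'a set \<Rightarrow> 'a set \<Rightarrow> 'a set \<Rightarrow> 'a set \<Rightarrow> bool" where
  "AC_connected_set meet join A B C X \<longleftrightarrow>
    X \<subseteq> B \<and> (\<forall>b\<in>X. \<forall>b'\<in>X. AC_connected meet join A B C b b')"

definition AC_component ::
  "('a \<Rightarrow> 'a \<Rightarrow> 'a) \<Rightarrow> ('a \<Rightarrow> 'a \<Rightarrow> 'a) \<Rightarrow> 'a set \<Rightarrow> 'a set \<Rightarrow> 'a set \<Rightarrow> 'a set \<Rightarrow> bool" where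
  "AC_component meet join A B C X \<longleftrightarrow>
    AC_connected_set meet join A B C X \<and>
    (\<forall>Y. AC_connected_set meet join A B C Y \<and> X \<subseteq> Y \<longrightarrow> Y = X)"

end

theory Submission
  imports Defs
begin

text \<open>
  The heart of the matter is the pair of maps that push an element \<open>b\<close> of the middle class between
  given elements \<open>a > c\<close>: first up past \<open>c\<close> and then down below \<open>a\<close>, which gives
  \<open>a \<and> (c \<or> b \<or> c) \<and> a\<close>, or in the other order, which gives \<open>c \<or> (a \<and> b \<and> a) \<or> c\<close>. Both results
  are midpoints of \<open>a\<close> and \<open>c\<close> in the component of \<open>b\<close>, and both maps fix every midpoint. The first
  depends only on the \<open>C\<close>-coset of \<open>b\<close>, the second only on its \<open>A\<close>-coset. Condition (ii) says that
  the two maps agree. Then their common value does not change along a chain of cosets, so it is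
  constant on components, and each component has just one midpoint. Conversely, where midpoints in
  a component are unique, the two maps must agree. This is (ii) \<open>\<longleftrightarrow>\<close> (iii)
  (\<open>median_law_iff_unique_midpoints\<close>).

  A coset bijection sends an element to the only element below it in the target coset. So the
  composite of the bijections through \<open>a > b > c\<close> is all of the coset bijection through \<open>a > c\<close>
  precisely if, for each \<open>a'\<close> in the \<open>C\<close>-coset of \<open>a\<close>, the element \<open>a' \<and> b \<and> a'\<close> stays in the
  \<open>C\<close>-coset of \<open>b\<close> (\<open>coset_map_comp\<close>). This property, together with nonempty intersections of
  cosets, is equivalent to uniqueness of midpoints in any chain of three classes
  (\<open>unique_midpoints_iff\<close>). A component again forms such a chain with \<open>A\<close> and \<open>C\<close>, whence
  (iii) \<open>\<longleftrightarrow>\<close> (iv). The factorization of a coset bijection through \<open>a > c\<close> must pass through a midpoint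
  of \<open>a\<close> and \<open>c\<close>, and a coset bijection is determined by a single pair in its graph, so existence and
  uniqueness of midpoints give existence and uniqueness of factorizations.

  Distributivity implies (ii) by expanding \<open>a \<and> (c \<or> b \<or> c) \<and> a\<close>. In the other direction, an instance
  of the first distributive law can fail only if the outer element is in \<open>A\<close> and the inner ones are
  in \<open>B\<close> and \<open>C\<close>, and the second law is dual to the first. In this case (ii), first freed of the assumption \<open>a > c\<close> (\<open>median_law_all\<close>), gives the two-sided
  expansion of \<open>a \<and> (c \<or> b \<or> c) \<and> a\<close>, and the one-sided laws follow because join and meet on \<open>B\<close>
  differ only by the order of the arguments (\<open>meet_distrib_mixed\<close>).

  All coset arguments rest on the identity \<open>x \<and> y \<and> x \<and> z \<and> x = x \<and> y \<and> z \<and> x\<close>, which holds in every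
  skew lattice (\<open>meet_regular\<close>). The axioms are symmetric under exchanging the operations, which
  reverses the order of the classes and turns \<open>A\<close>-cosets in \<open>B\<close> into \<open>B\<close>-cosets in \<open>A\<close>; this halves
  the work throughout.
\<close>

section \<open>Regularity and the natural orders\<close>
context skew_lattice
begin

lemma dual: "skew_lattice S (\<squnion>) (\<sqinter>)"
  by unfold_locales
    (simp_all add: meet_closed join_closed meet_assoc join_assoc meet_idem join_idem
      meet_join_absorb join_meet_absorb_right join_meet_absorb meet_join_absorb_right)

lemma meet_left_idem: "\<lbrakk>x \<in> S; y \<in> S\<rbrakk> \<Longrightarrow> x \<sqinter> (x \<sqinter> y) = x \<sqinter> y"
  by (metis meet_assoc meet_idem)

lemma meet_pair_idem: "\<lbrakk>x \<in> S; y \<in> S; z \<in> S\<rbrakk> \<Longrightarrow> x \<sqinter> (y \<sqinter> (x \<sqinter> (y \<sqinter> z))) = x \<sqinter> (y \<sqinter> z)"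
  by (metis meet_assoc meet_idem meet_closed)

lemma meet_absorb_left:
  "\<lbrakk>x \<in> S; y \<in> S; z \<in> S; x \<sqinter> y \<sqinter> x = x\<rbrakk> \<Longrightarrow> x \<sqinter> (y \<sqinter> (x \<sqinter> z)) = x \<sqinter> z"
  by (metis meet_assoc meet_closed)

text \<open>
  The element \<open>w = (x \<squnion> z) \<sqinter> x\<close> satisfies \<open>x \<sqinter> w = x\<close> and \<open>w \<sqinter> x = w\<close>. Regularity requires that
  such a \<open>w\<close> may replace \<open>x\<close> after a factor \<open>x \<sqinter> y\<close>. The element \<open>v = (x \<sqinter> y) \<squnion> x\<close> mediates: as
  \<open>x \<sqinter> y \<sqinter> v = x \<sqinter> y\<close>, it can be inserted after that factor, and \<open>v \<sqinter> w = x\<close>.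
\<close>

lemma meet_insert_join:
  assumes S: "x \<in> S" "y \<in> S" "z \<in> S"
  shows "x \<sqinter> y \<sqinter> (x \<squnion> z) \<sqinter> x = x \<sqinter> y \<sqinter> x"
proof -
  define v where "v = (x \<sqinter> y) \<squnion> x"
  define s where "s = x \<squnion> z"
  have vS: "v \<in> S" and sS: "s \<in> S"
    using S by (simp_all add: v_def s_def meet_closed join_closed)
  note [simp] = S vS sS meet_closed join_closed meet_assoc
  have v1: "x \<sqinter> (y \<sqinter> v) = x \<sqinter> y"
    using meet_join_absorb[of "x \<sqinter> y" x] by (simp add: v_def)
  have v2: "v \<sqinter> x = x"
    using join_meet_absorb_right[of x "x \<sqinter> y"] by (simp add: v_def)
  have "x \<squnion> v = x"
    by (metis v_def join_assoc join_meet_absorb join_idem S meet_closed)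
  then have v3: "x \<sqinter> v = v"
    by (metis join_meet_absorb_right S(1) vS)
  have s1: "x \<sqinter> s = x"
    using S by (simp add: s_def meet_join_absorb)
  have "v \<sqinter> (s \<sqinter> x) = x \<sqinter> (s \<sqinter> (v \<sqinter> (s \<sqinter> (v \<sqinter> x))))"
    by (metis v2 v3 s1 meet_assoc meet_closed S(1) vS sS)
  also have "\<dots> = x \<sqinter> (s \<sqinter> (v \<sqinter> x))"
    by (simp add: meet_pair_idem)
  also have "\<dots> = x"
    by (metis v2 s1 meet_assoc meet_idem S(1) sS)
  finally have vsx: "v \<sqinter> (s \<sqinter> x) = x" .
  have "x \<sqinter> (y \<sqinter> (s \<sqinter> x)) = x \<sqinter> (y \<sqinter> (v \<sqinter> (s \<sqinter> x)))"
    by (metis v1 meet_assoc meet_closed S(1,2) vS sS)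
  then show ?thesis
    by (simp add: vsx s_def[symmetric])
qed

text \<open>
  With \<open>u = x \<squnion> (z \<sqinter> x)\<close>, absorption gives \<open>u \<sqinter> (z \<sqinter> x) = z \<sqinter> x\<close> and \<open>u \<sqinter> x = u\<close>, so the
  preceding lemma allows \<open>x \<sqinter> y \<sqinter> x\<close> to be replaced by \<open>x \<sqinter> y \<sqinter> u\<close>, whose last factor then
  disappears into \<open>z \<sqinter> x\<close>.
\<close>

lemma meet_regular:
  assumes S: "x \<in> S" "y \<in> S" "z \<in> S"
  shows "x \<sqinter> y \<sqinter> x \<sqinter> z \<sqinter> x = x \<sqinter> y \<sqinter> z \<sqinter> x"
proof -
  define e where "e = z \<sqinter> x"
  define u where "u = x \<squnion> e"
  have eS: "e \<in> S" and uS: "u \<in> S"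
    using S by (simp_all add: e_def u_def meet_closed join_closed)
  note [simp] = S eS uS meet_closed join_closed meet_assoc
  have ue: "u \<sqinter> e = e"
    by (simp add: u_def join_meet_absorb_right)
  have "u \<squnion> x = x"
    by (metis u_def e_def join_assoc meet_join_absorb_right join_idem S eS)
  then have ux: "u \<sqinter> x = u"
    by (metis meet_join_absorb S(1) uS)
  have "x \<sqinter> (y \<sqinter> u) = x \<sqinter> (y \<sqinter> x)"
    using meet_insert_join[of x y e] by (simp add: u_def[symmetric] ux)
  then have "x \<sqinter> (y \<sqinter> (x \<sqinter> e)) = x \<sqinter> (y \<sqinter> (u \<sqinter> e))"
    by (metis meet_assoc meet_closed S(1,2) uS eS)
  then show ?thesis
    by (simp add: ue) (simp add: e_def)
qed

lemma join_regular:
  "\<lbrakk>x \<in> S; y \<in> S; z \<in> S\<rbrakk> \<Longrightarrow> x \<squnion> y \<squnion> x \<squnion> z \<squnion> x = x \<squnion> y \<squnion> z \<squnion> x"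
  by (rule skew_lattice.meet_regular[OF dual])

lemma meet_absorb_of_join_absorb:
  assumes S: "x \<in> S" "y \<in> S" and xyx: "x \<squnion> y \<squnion> x = x"
  shows "y \<sqinter> x \<sqinter> y = y"
proof -
  define q where "q = y \<squnion> x"
  have qS: "q \<in> S" using S by (simp add: q_def join_closed)
  have "x \<squnion> q = x" using xyx S by (simp add: q_def join_assoc)
  then have "x \<sqinter> q = q" by (metis join_meet_absorb_right S(1) qS)
  then have y: "y = y \<sqinter> (x \<sqinter> q)" using S by (simp add: q_def meet_join_absorb)
  then have "y \<sqinter> x \<sqinter> y = y \<sqinter> (x \<sqinter> (y \<sqinter> (x \<sqinter> q)))"
    by (metis S qS meet_assoc meet_closed)
  also have "\<dots> = y" using S qS by (metis y meet_pair_idem)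
  finally show ?thesis .
qed

text \<open>
  The natural preorder can be read off from either operation. This carries facts about
  \<open>\<D>\<close>-classes across the duality.
\<close>

lemma join_absorb_iff_meet_absorb:
  assumes "x \<in> S" "y \<in> S"
  shows "x \<squnion> y \<squnion> x = x \<longleftrightarrow> y \<sqinter> x \<sqinter> y = y"
  using meet_absorb_of_join_absorb[OF assms]
    skew_lattice.meet_absorb_of_join_absorb[OF dual assms(2,1)] by blast

lemma preorder_ge_iff_meet:
  "\<lbrakk>x \<in> S; y \<in> S\<rbrakk> \<Longrightarrow> preorder_ge (\<squnion>) x y \<longleftrightarrow> y \<sqinter> x \<sqinter> y = y"
  by (simp add: preorder_ge_def join_absorb_iff_meet_absorb)

text \<open>
  Transitivity of the natural preorder. Regularity lets the factor \<open>z\<close> in \<open>y \<sqinter> x \<sqinter> z \<sqinter> x \<sqinter> y\<close> be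
  surrounded by copies of \<open>y\<close>, between which it vanishes.
\<close>

lemma meet_absorb_trans:
  assumes S: "x \<in> S" "y \<in> S" "z \<in> S"
    and xy: "x \<sqinter> y \<sqinter> x = x" and yz: "y \<sqinter> z \<sqinter> y = y"
  shows "x \<sqinter> z \<sqinter> x = x"
proof -
  note [simp] = S meet_closed meet_assoc
  have "y \<sqinter> (x \<sqinter> (z \<sqinter> (x \<sqinter> y))) = y \<sqinter> (x \<sqinter> (y \<sqinter> (z \<sqinter> (y \<sqinter> (x \<sqinter> y)))))"
    using meet_regular[of y x "z \<sqinter> x"] meet_regular[of y "x \<sqinter> y \<sqinter> z" x] by simp
  also have "\<dots> = y \<sqinter> (x \<sqinter> y)"
    using yz by (simp add: meet_absorb_left meet_pair_idem meet_idem)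
  finally have yxzxy: "y \<sqinter> (x \<sqinter> (z \<sqinter> (x \<sqinter> y))) = y \<sqinter> (x \<sqinter> y)" .
  have "x \<sqinter> z \<sqinter> x = x \<sqinter> (y \<sqinter> (x \<sqinter> (z \<sqinter> (x \<sqinter> (y \<sqinter> x)))))"
    using xy by (simp add: meet_absorb_left)
  also have "\<dots> = x \<sqinter> (y \<sqinter> (x \<sqinter> (z \<sqinter> (x \<sqinter> y)))) \<sqinter> x"
    by simp
  also have "\<dots> = x"
    using xy by (simp only: yxzxy) (simp add: meet_absorb_left)
  finally show ?thesis .
qed

lemma natural_ge_dual:
  assumes "x \<in> S" "y \<in> S"
  shows "natural_ge (\<squnion>) y x \<longleftrightarrow> natural_ge (\<sqinter>) x y"
  unfolding natural_ge_def using assms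
  by (metis meet_join_absorb join_meet_absorb_right join_meet_absorb meet_join_absorb_right)

lemma natural_gt_dual:
  assumes "x \<in> S" "y \<in> S"
  shows "natural_gt (\<squnion>) y x \<longleftrightarrow> natural_gt (\<sqinter>) x y"
  using natural_ge_dual[OF assms] by (auto simp: natural_gt_def)

end

section \<open>Cosets for a pair of comparable classes\<close>

text \<open>
  The locale keeps only what coset arguments use of two \<open>\<D>\<close>-classes \<open>A > B\<close>. It does not ask for
  whole \<open>\<D>\<close>-classes of \<open>S\<close>, so that a component of the middle class of a chain can take the place of
  either set, and its assumptions are preserved when the operations and the two sets are exchanged.
\<close>

locale class_pair = skew_lattice S meet join
  for S :: "'a set"
    and meet :: "'a \<Rightarrow> 'a \<Rightarrow> 'a" (infixl "\<sqinter>" 70)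
    and join :: "'a \<Rightarrow> 'a \<Rightarrow> 'a" (infixl "\<squnion>" 65) +
  fixes A B :: "'a set"
  assumes A_sub: "A \<subseteq> S" and B_sub: "B \<subseteq> S"
    and A_ne: "A \<noteq> {}" and B_ne: "B \<noteq> {}"
    and disjoint: "A \<inter> B = {}"
    and meet_A: "\<lbrakk>x \<in> A; y \<in> A\<rbrakk> \<Longrightarrow> x \<sqinter> y \<in> A"
    and join_A: "\<lbrakk>x \<in> A; y \<in> A\<rbrakk> \<Longrightarrow> x \<squnion> y \<in> A"
    and rect_A: "\<lbrakk>x \<in> A; y \<in> A\<rbrakk> \<Longrightarrow> x \<sqinter> y \<sqinter> x = x"
    and meet_B: "\<lbrakk>x \<in> B; y \<in> B\<rbrakk> \<Longrightarrow> x \<sqinter> y \<in> B"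
    and join_B: "\<lbrakk>x \<in> B; y \<in> B\<rbrakk> \<Longrightarrow> x \<squnion> y \<in> B"
    and rect_B: "\<lbrakk>x \<in> B; y \<in> B\<rbrakk> \<Longrightarrow> x \<sqinter> y \<sqinter> x = x"
    and meet_AB: "\<lbrakk>a \<in> A; b \<in> B\<rbrakk> \<Longrightarrow> a \<sqinter> b \<in> B"
    and meet_BA: "\<lbrakk>a \<in> A; b \<in> B\<rbrakk> \<Longrightarrow> b \<sqinter> a \<in> B"
    and join_AB: "\<lbrakk>a \<in> A; b \<in> B\<rbrakk> \<Longrightarrow> a \<squnion> b \<in> A"
    and join_BA: "\<lbrakk>a \<in> A; b \<in> B\<rbrakk> \<Longrightarrow> b \<squnion> a \<in> A"
    and B_below_A: "\<lbrakk>a \<in> A; b \<in> B\<rbrakk> \<Longrightarrow> b \<sqinter> a \<sqinter> b = b"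
begin

lemma inA: "a \<in> A \<Longrightarrow> a \<in> S" and inB: "b \<in> B \<Longrightarrow> b \<in> S"
  using A_sub B_sub by auto

lemma join_rect_A: "\<lbrakk>x \<in> A; y \<in> A\<rbrakk> \<Longrightarrow> x \<squnion> y \<squnion> x = x"
  by (simp add: join_absorb_iff_meet_absorb inA rect_A)

lemma join_rect_B: "\<lbrakk>x \<in> B; y \<in> B\<rbrakk> \<Longrightarrow> x \<squnion> y \<squnion> x = x"
  by (simp add: join_absorb_iff_meet_absorb inB rect_B)

lemma A_above_B: "\<lbrakk>a \<in> A; b \<in> B\<rbrakk> \<Longrightarrow> a \<squnion> b \<squnion> a = a"
  by (simp add: join_absorb_iff_meet_absorb inA inB B_below_A)

lemma dual_pair: "class_pair S (\<squnion>) (\<sqinter>) B A"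
proof -
  interpret dual: skew_lattice S "(\<squnion>)" "(\<sqinter>)" by (rule dual)
  show ?thesis
    by unfold_locales
      (use A_sub B_sub A_ne B_ne disjoint in \<open>auto simp: meet_A join_A meet_B join_B meet_AB
        meet_BA join_AB join_BA join_rect_A join_rect_B A_above_B\<close>)
qed

text \<open>
  For \<open>p = x \<squnion> y\<close> the rectangular identity gives \<open>p = p \<sqinter> (y \<sqinter> x) \<sqinter> p\<close>, and the two outer
  factors disappear because \<open>p \<sqinter> y = y\<close> and \<open>x \<sqinter> p = x\<close> by absorption.
\<close>

lemma join_eq_flipped_meet_B:
  assumes "x \<in> B" "y \<in> B"
  shows "x \<squnion> y = y \<sqinter> x"
proof -
  let ?p = "x \<squnion> y"
  have p: "?p \<in> B" using assms by (rule join_B)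
  note S = assms[THEN inB] p[THEN inB]
  have "?p = ?p \<sqinter> (y \<sqinter> x) \<sqinter> ?p"
    using p assms by (simp add: rect_B meet_B)
  also have "\<dots> = (?p \<sqinter> y) \<sqinter> (x \<sqinter> ?p)"
    using S by (simp add: meet_assoc meet_closed)
  also have "\<dots> = y \<sqinter> x"
    using S by (simp add: join_meet_absorb_right meet_join_absorb)
  finally show ?thesis .
qed

text \<open>
  A single \<open>a \<in> A\<close> suffices to tell the \<open>A\<close>-cosets in \<open>B\<close> apart: regularity removes from
  \<open>a \<sqinter> (x \<sqinter> b \<sqinter> y) \<sqinter> a\<close> the factors from \<open>A\<close> inside. In return, if \<open>b'\<close> and \<open>b\<close> have the same
  image below \<open>a\<close>, then \<open>b'\<close> is recovered from that image by multiplying with an element of \<open>A\<close>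
  above \<open>b'\<close>.
\<close>

lemma meet_coset_iff:
  assumes a: "a \<in> A" and b: "b \<in> B"
  shows "b' \<in> meet_coset (\<sqinter>) A b \<longleftrightarrow> b' \<in> B \<and> a \<sqinter> b' \<sqinter> a = a \<sqinter> b \<sqinter> a"
proof
  assume "b' \<in> meet_coset (\<sqinter>) A b"
  then obtain x y where xy: "x \<in> A" "y \<in> A" and b': "b' = x \<sqinter> b \<sqinter> y"
    by (auto simp: meet_coset_def)
  note S [simp] = inA[OF a] inB[OF b] inA[OF xy(1)] inA[OF xy(2)] meet_closed meet_assoc
  have "a \<sqinter> b' \<sqinter> a = a \<sqinter> x \<sqinter> (b \<sqinter> y) \<sqinter> a"
    by (simp add: b')
  also have "\<dots> = a \<sqinter> x \<sqinter> a \<sqinter> (b \<sqinter> y) \<sqinter> a"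
    by (rule meet_regular[symmetric]) simp_all
  also have "\<dots> = a \<sqinter> b \<sqinter> y \<sqinter> a"
    using rect_A[OF a xy(1)] by (simp add: meet_absorb_left)
  also have "\<dots> = a \<sqinter> b \<sqinter> a \<sqinter> y \<sqinter> a"
    by (rule meet_regular[symmetric]) simp_all
  also have "\<dots> = a \<sqinter> b \<sqinter> a"
    using rect_A[OF a xy(2)] by simp
  finally show "b' \<in> B \<and> a \<sqinter> b' \<sqinter> a = a \<sqinter> b \<sqinter> a"
    using xy b by (simp del: meet_assoc add: b' meet_AB meet_BA)
next
  assume r: "b' \<in> B \<and> a \<sqinter> b' \<sqinter> a = a \<sqinter> b \<sqinter> a"
  \<comment> \<open>an element of \<open>A\<close> above \<open>b'\<close>\<close>
  define w where "w = b' \<squnion> a \<squnion> b'"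
  have w: "w \<in> A" using r a by (simp add: w_def join_AB join_BA)
  have b': "b' \<in> S" using r inB by blast
  note [simp] = inA[OF a] inB[OF b] b' inA[OF w] meet_closed join_closed
  have wb: "w \<sqinter> b' = b'" "b' \<sqinter> w = b'"
    using join_meet_absorb_right[of b' "b' \<squnion> a"] meet_join_absorb[of b' "a \<squnion> b'"]
    by (simp_all add: w_def join_assoc)
  have "b' = w \<sqinter> a \<sqinter> w \<sqinter> b' \<sqinter> (w \<sqinter> a \<sqinter> w)"
    using rect_A[OF w a] by (simp add: wb)
  also have "\<dots> = w \<sqinter> (a \<sqinter> (w \<sqinter> b' \<sqinter> w) \<sqinter> a) \<sqinter> w"
    by (simp add: meet_assoc)
  also have "\<dots> = (w \<sqinter> a) \<sqinter> b \<sqinter> (a \<sqinter> w)"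
    using r by (simp add: wb) (simp add: meet_assoc)
  finally show "b' \<in> meet_coset (\<sqinter>) A b"
    unfolding meet_coset_def using w a meet_A by blast
qed

lemma coset_subset: "b \<in> B \<Longrightarrow> meet_coset (\<sqinter>) A b \<subseteq> B"
  using meet_coset_iff A_ne by blast

lemma coset_self: "b \<in> B \<Longrightarrow> b \<in> meet_coset (\<sqinter>) A b"
  using meet_coset_iff A_ne by blast

lemma coset_eq: "\<lbrakk>b \<in> B; b' \<in> meet_coset (\<sqinter>) A b\<rbrakk> \<Longrightarrow> meet_coset (\<sqinter>) A b' = meet_coset (\<sqinter>) A b"
  using meet_coset_iff A_ne by auto

lemma natural_ge_meet:
  assumes "a \<in> A" "b \<in> B"
  shows "natural_ge (\<sqinter>) a (a \<sqinter> b \<sqinter> a)"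
  using assms by (simp add: natural_ge_def inA inB meet_closed meet_assoc meet_left_idem meet_idem)

lemma natural_gt_iff: "\<lbrakk>a \<in> A; b \<in> B\<rbrakk> \<Longrightarrow> natural_gt (\<sqinter>) a b \<longleftrightarrow> natural_ge (\<sqinter>) a b"
  using disjoint by (auto simp: natural_gt_def)

lemma natural_ge_iff:
  assumes "a \<in> A" "b \<in> B"
  shows "natural_ge (\<sqinter>) a b \<longleftrightarrow> a \<sqinter> b \<sqinter> a = b"
  using natural_ge_meet[OF assms] assms
  by (auto simp: natural_ge_def)

lemma meet_in_coset:
  assumes "a \<in> A" "b \<in> B"
  shows "a \<sqinter> b \<sqinter> a \<in> meet_coset (\<sqinter>) A b"
  using assms unfolding meet_coset_def by blast

text \<open>
  Each \<open>A\<close>-coset in \<open>B\<close> contains exactly one element below a given \<open>a \<in> A\<close>. Together with the dual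
  statement this is why the order between two cosets is the graph of a bijection.
\<close>

lemma below_in_coset_iff:
  assumes "a \<in> A" "b \<in> B"
  shows "b' \<in> meet_coset (\<sqinter>) A b \<and> natural_ge (\<sqinter>) a b' \<longleftrightarrow> b' = a \<sqinter> b \<sqinter> a"
  using assms meet_coset_iff natural_ge_iff natural_ge_meet meet_in_coset by metis

text \<open>
  By this identity and the criterion for membership in a coset, lying in the same \<open>A\<close>-coset is a
  congruence for the meet on \<open>B\<close>.
\<close>

lemma meet_meet_cong:
  assumes a: "a \<in> A" and b: "b \<in> B" and x: "x \<in> B"
  shows "a \<sqinter> (b \<sqinter> x) \<sqinter> a = (a \<sqinter> b \<sqinter> a) \<sqinter> (a \<sqinter> x \<sqinter> a)"
  using meet_regular[of a b x] assms
  by (simp add: inA inB meet_assoc meet_closed meet_left_idem)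

end

text \<open>
  The coset bijection from the \<open>B\<close>-coset of \<open>a\<close> to the \<open>A\<close>-coset of \<open>b\<close>, with its values computed
  by a formula. The elements \<open>a\<close> and \<open>b\<close> only name the two cosets; they need not correspond.
\<close>

definition coset_map ::
  "('a \<Rightarrow> 'a \<Rightarrow> 'a) \<Rightarrow> ('a \<Rightarrow> 'a \<Rightarrow> 'a) \<Rightarrow> 'a set \<Rightarrow> 'a \<Rightarrow> 'a \<Rightarrow> 'a \<rightharpoonup> 'a" where
  "coset_map meet join B a b =
    (\<lambda>x. if x \<in> join_coset join B a then Some (meet (meet x b) x) else None)"

lemma join_coset_eq_meet_coset: "join_coset = meet_coset"
  by (simp add: fun_eq_iff join_coset_def meet_coset_def)

context class_pair
begin

interpretation dual: class_pair S "(\<squnion>)" "(\<sqinter>)" B A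
  by (rule dual_pair)

lemmas join_coset_iff = dual.meet_coset_iff[folded join_coset_eq_meet_coset]
lemmas join_coset_subset = dual.coset_subset[folded join_coset_eq_meet_coset]
lemmas join_coset_self = dual.coset_self[folded join_coset_eq_meet_coset]
lemmas join_coset_eq = dual.coset_eq[folded join_coset_eq_meet_coset]

lemma natural_ge_join:
  "\<lbrakk>a \<in> A; b \<in> B\<rbrakk> \<Longrightarrow> natural_ge (\<sqinter>) (b \<squnion> a \<squnion> b) b"
  using dual.natural_ge_meet natural_ge_dual by (metis inA inB join_BA join_AB)

lemma natural_ge_iff_join:
  "\<lbrakk>a \<in> A; b \<in> B\<rbrakk> \<Longrightarrow> natural_ge (\<sqinter>) a b \<longleftrightarrow> b \<squnion> a \<squnion> b = a"
  using dual.natural_ge_iff natural_ge_dual by (metis inA inB)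

lemma above_in_coset_iff:
  "\<lbrakk>a \<in> A; b \<in> B\<rbrakk> \<Longrightarrow>
    a' \<in> join_coset (\<squnion>) B a \<and> natural_ge (\<sqinter>) a' b \<longleftrightarrow> a' = b \<squnion> a \<squnion> b"
  using dual.below_in_coset_iff[folded join_coset_eq_meet_coset] natural_ge_dual
    join_coset_subset by (metis inA inB subsetD join_BA join_AB)

lemma coset_bijection_iff_coset_map:
  "coset_bijection (\<sqinter>) (\<squnion>) A B \<phi> \<longleftrightarrow> (\<exists>a\<in>A. \<exists>b\<in>B. \<phi> = coset_map (\<sqinter>) (\<squnion>) B a b)"
proof
  assume "coset_bijection (\<sqinter>) (\<squnion>) A B \<phi>"
  then obtain a b where a: "a \<in> A" and b: "b \<in> B"
    and dom: "dom \<phi> = join_coset (\<squnion>) B a"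
    and \<phi>: "\<And>x y. \<phi> x = Some y \<longleftrightarrow>
      x \<in> join_coset (\<squnion>) B a \<and> y \<in> meet_coset (\<sqinter>) A b \<and> natural_gt (\<sqinter>) x y"
    unfolding coset_bijection_def join_cosets_def meet_cosets_def by blast
  have "\<phi> x = coset_map (\<sqinter>) (\<squnion>) B a b x" for x
  proof (cases "x \<in> join_coset (\<squnion>) B a")
    case True
    then have x: "x \<in> A" using join_coset_subset a by blast
    have "\<phi> x = Some (x \<sqinter> b \<sqinter> x)"
      unfolding \<phi> using True x b
      by (simp add: meet_in_coset natural_gt_iff natural_ge_meet meet_AB meet_BA)
    then show ?thesis using True by (simp add: coset_map_def)
  next
    case False
    then show ?thesis using dom by (auto simp: coset_map_def)
  qed
  then show "\<exists>a\<in>A. \<exists>b\<in>B. \<phi> = coset_map (\<sqinter>) (\<squnion>) B a b"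
    using a b by blast
next
  assume "\<exists>a\<in>A. \<exists>b\<in>B. \<phi> = coset_map (\<sqinter>) (\<squnion>) B a b"
  then obtain a b where a: "a \<in> A" and b: "b \<in> B" and \<phi>: "\<phi> = coset_map (\<sqinter>) (\<squnion>) B a b"
    by blast
  let ?X = "join_coset (\<squnion>) B a" and ?Y = "meet_coset (\<sqinter>) A b"
  have XA: "?X \<subseteq> A" and YB: "?Y \<subseteq> B" using a b join_coset_subset coset_subset by auto
  have graph: "\<phi> x = Some y \<longleftrightarrow> x \<in> ?X \<and> y \<in> ?Y \<and> natural_ge (\<sqinter>) x y" for x y
    using below_in_coset_iff[of x b y] XA b by (auto simp: \<phi> coset_map_def)
  have up: "\<phi> x = Some y \<longleftrightarrow> y \<in> ?Y \<and> x = y \<squnion> a \<squnion> y" for x y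
    using above_in_coset_iff[of a y x] YB a by (auto simp: graph)
  have "dom \<phi> = ?X" by (auto simp: \<phi> coset_map_def split: if_splits)
  moreover have "ran \<phi> = ?Y" by (auto simp: ran_def up)
  moreover have "inj_on \<phi> ?X"
    by (rule inj_onI) (metis up \<phi> coset_map_def)
  moreover have "\<forall>x y. \<phi> x = Some y \<longleftrightarrow> x \<in> ?X \<and> y \<in> ?Y \<and> natural_gt (\<sqinter>) x y"
    using graph XA YB natural_gt_iff by blast
  ultimately show "coset_bijection (\<sqinter>) (\<squnion>) A B \<phi>"
    unfolding coset_bijection_def join_cosets_def meet_cosets_def using a b by blast
qed

text \<open>
  Any pair in the graph of a coset bijection determines the bijection, as its two elements name the
  two cosets.
\<close>

lemma coset_map_Some:
  assumes a: "a \<in> A" and b: "b \<in> B" and xy: "coset_map (\<sqinter>) (\<squnion>) B a b x = Some y"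
  shows "x \<in> A" and "y \<in> B" and "natural_ge (\<sqinter>) x y"
    and "coset_map (\<sqinter>) (\<squnion>) B a b = coset_map (\<sqinter>) (\<squnion>) B x y"
proof -
  have x: "x \<in> join_coset (\<squnion>) B a" and y: "y = x \<sqinter> b \<sqinter> x"
    using xy by (auto simp: coset_map_def split: if_splits)
  show xA: "x \<in> A" using x join_coset_subset a by blast
  show yB: "y \<in> B" using xA b y by (simp add: meet_AB meet_BA)
  show "natural_ge (\<sqinter>) x y" using xA b y natural_ge_meet by blast
  have yb: "y \<in> meet_coset (\<sqinter>) A b" using meet_in_coset xA b y by blast
  have "z \<sqinter> b \<sqinter> z = z \<sqinter> y \<sqinter> z" if "z \<in> join_coset (\<squnion>) B a" for z
    using meet_coset_iff[of z b y] yb that join_coset_subset[OF a] b by auto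
  then show "coset_map (\<sqinter>) (\<squnion>) B a b = coset_map (\<sqinter>) (\<squnion>) B x y"
    by (auto simp: coset_map_def fun_eq_iff join_coset_eq[OF a x])
qed

lemma coset_map_self:
  assumes "a \<in> A" "b \<in> B" "natural_ge (\<sqinter>) a b"
  shows "coset_map (\<sqinter>) (\<squnion>) B a b a = Some b"
  using assms natural_ge_iff join_coset_self by (simp add: coset_map_def)

end

section \<open>Midpoints in a chain of three classes\<close>

locale class_triple = skew_lattice S meet join +
  AB: class_pair S meet join A B + BC: class_pair S meet join B C + AC: class_pair S meet join A C
  for S :: "'a set"
    and meet :: "'a \<Rightarrow> 'a \<Rightarrow> 'a" (infixl "\<sqinter>" 70)
    and join :: "'a \<Rightarrow> 'a \<Rightarrow> 'a" (infixl "\<squnion>" 65)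
    and A B C :: "'a set"
begin

lemma dual_triple: "class_triple S (\<squnion>) (\<sqinter>) C B A"
  unfolding class_triple_def using dual AB.dual_pair BC.dual_pair AC.dual_pair by blast

lemma natural_ge_trans:
  assumes "x \<in> S" "y \<in> S" "z \<in> S" "natural_ge (\<sqinter>) x y" "natural_ge (\<sqinter>) y z"
  shows "natural_ge (\<sqinter>) x z"
  using assms unfolding natural_ge_def by (metis meet_assoc)

lemma midpoint_iff:
  assumes "a \<in> A" "c \<in> C"
  shows "midpoint (\<sqinter>) B a c b \<longleftrightarrow> b \<in> B \<and> natural_ge (\<sqinter>) a b \<and> natural_ge (\<sqinter>) b c"
  using assms AB.natural_gt_iff BC.natural_gt_iff by (auto simp: midpoint_def)

text \<open>
  Pushing \<open>b\<close> up past \<open>c\<close> and then down below \<open>a\<close> keeps it above \<open>c\<close>, because \<open>c\<close> lies below \<open>a\<close>.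
\<close>

lemma midpoint_meet:
  assumes a: "a \<in> A" and b: "b \<in> B" and c: "c \<in> C" and ac: "natural_ge (\<sqinter>) a c"
  shows "midpoint (\<sqinter>) B a c (a \<sqinter> (c \<squnion> b \<squnion> c) \<sqinter> a)"
proof -
  let ?d = "c \<squnion> b \<squnion> c"
  have d: "?d \<in> B" using b c by (simp add: BC.join_AB BC.join_BA)
  have dc: "natural_ge (\<sqinter>) ?d c" using b c by (rule BC.natural_ge_join)
  have "natural_ge (\<sqinter>) (a \<sqinter> ?d \<sqinter> a) c"
    using ac dc AB.inA[OF a] AB.inB[OF d] BC.inB[OF c] unfolding natural_ge_def
    by (metis meet_assoc meet_closed)
  then show ?thesis
    using a b c d AB.natural_ge_meet[OF a d] by (simp add: midpoint_iff AB.meet_AB AB.meet_BA)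
qed

lemma midpoint_dual:
  assumes "a \<in> A" "c \<in> C"
  shows "midpoint (\<squnion>) B c a b \<longleftrightarrow> midpoint (\<sqinter>) B a c b"
  using assms natural_gt_dual by (auto simp: midpoint_def AB.inA AB.inB BC.inB)

lemma midpoint_join:
  assumes a: "a \<in> A" and b: "b \<in> B" and c: "c \<in> C" and ac: "natural_ge (\<sqinter>) a c"
  shows "midpoint (\<sqinter>) B a c (c \<squnion> (a \<sqinter> b \<sqinter> a) \<squnion> c)"
  using class_triple.midpoint_meet[OF dual_triple c b a] midpoint_dual[OF a c] ac natural_ge_dual
  by (metis AB.inA BC.inB a c)

text \<open>
  In general the join is not monotone for the natural partial order of a skew lattice. Here it is, because
  the factors from \<open>C\<close> that end up between copies of \<open>b\<close> are absorbed.
\<close>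

lemma translate_up_mono:
  assumes a: "a \<in> A" and b: "b \<in> B" and c: "c \<in> C" "c' \<in> C" and ab: "natural_ge (\<sqinter>) a b"
  shows "natural_ge (\<sqinter>) (c \<squnion> a \<squnion> c') (c \<squnion> b \<squnion> c')"
proof -
  note [simp] = AB.inA[OF a] AB.inB[OF b] c[THEN BC.inB] join_closed join_assoc
  have ba: "b \<squnion> a = a" "a \<squnion> b = a"
    using ab natural_ge_dual[of a b] by (auto simp: natural_ge_def)
  have b1: "b \<squnion> (c' \<squnion> c) \<squnion> b = b"
    using b c by (intro BC.A_above_B) (simp_all add: BC.join_B)
  have "c \<squnion> b \<squnion> c' \<squnion> (c \<squnion> a \<squnion> c') = c \<squnion> (b \<squnion> (c' \<squnion> c) \<squnion> b) \<squnion> a \<squnion> c'"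
    using ba by simp
  also have "\<dots> = c \<squnion> a \<squnion> c'"
    unfolding b1 using ba by simp
  finally have 1: "c \<squnion> b \<squnion> c' \<squnion> (c \<squnion> a \<squnion> c') = c \<squnion> a \<squnion> c'" .
  have "c \<squnion> a \<squnion> c' \<squnion> (c \<squnion> b \<squnion> c') = c \<squnion> (a \<squnion> b) \<squnion> (c' \<squnion> c) \<squnion> b \<squnion> c'"
    using ba by simp
  also have "\<dots> = c \<squnion> a \<squnion> (b \<squnion> (c' \<squnion> c) \<squnion> b) \<squnion> c'"
    by simp
  also have "\<dots> = c \<squnion> a \<squnion> c'"
    unfolding b1 using ba by (metis join_assoc AB.inA AB.inB a b c BC.inB join_closed)
  finally have "natural_ge (\<squnion>) (c \<squnion> b \<squnion> c') (c \<squnion> a \<squnion> c')"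
    using 1 by (simp only: natural_ge_def)
  then show ?thesis
    by (subst (asm) natural_ge_dual) simp_all
qed

definition unique_midpoints :: bool where
  "unique_midpoints \<longleftrightarrow>
    (\<forall>a\<in>A. \<forall>c\<in>C. natural_ge (\<sqinter>) a c \<longrightarrow> (\<exists>!b. midpoint (\<sqinter>) B a c b))"

definition cosets_intersect :: bool where
  "cosets_intersect \<longleftrightarrow>
    (\<forall>b\<in>B. \<forall>b'\<in>B. meet_coset (\<sqinter>) A b \<inter> join_coset (\<squnion>) C b' \<noteq> {})"

text \<open>
  The map sending \<open>a'\<close> to the element below it in the \<open>A\<close>-coset of \<open>b\<close> maps a \<open>C\<close>-coset in \<open>A\<close> into a
  \<open>C\<close>-coset in \<open>B\<close>. This is what it takes for composites of coset bijections to be as large as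
  possible, stated without partial maps.
\<close>

definition descent_respects_cosets :: bool where
  "descent_respects_cosets \<longleftrightarrow>
    (\<forall>a\<in>A. \<forall>b\<in>B. natural_ge (\<sqinter>) a b \<longrightarrow>
      (\<forall>a'\<in>join_coset (\<squnion>) C a. a' \<sqinter> b \<sqinter> a' \<in> join_coset (\<squnion>) C b))"

text \<open>
  Every element \<open>b'\<close> of \<open>B\<close> is a midpoint, for suitable \<open>a\<close> and \<open>c\<close>. The midpoint
  \<open>c \<squnion> (a \<sqinter> b \<sqinter> a) \<squnion> c\<close> must then be \<open>b'\<close>, which says that \<open>a \<sqinter> b \<sqinter> a\<close> is in the \<open>C\<close>-coset of \<open>b'\<close>
  as well as in the \<open>A\<close>-coset of \<open>b\<close>.
\<close>

lemma cosets_intersect_if_unique_midpoints: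
  assumes unique_midpoints
  shows cosets_intersect
  unfolding cosets_intersect_def
proof (intro ballI)
  fix b b' assume b: "b \<in> B" and b': "b' \<in> B"
  obtain a0 c0 where a0: "a0 \<in> A" and c0: "c0 \<in> C" using AB.A_ne BC.B_ne by blast
  define a where "a = b' \<squnion> a0 \<squnion> b'"
  define c where "c = b' \<sqinter> c0 \<sqinter> b'"
  have a: "a \<in> A" and ab': "natural_ge (\<sqinter>) a b'"
    using a0 b' AB.natural_ge_join by (auto simp: a_def AB.join_AB AB.join_BA)
  have c: "c \<in> C" and b'c: "natural_ge (\<sqinter>) b' c"
    using c0 b' BC.natural_ge_meet by (auto simp: c_def BC.meet_AB BC.meet_BA)
  have ac: "natural_ge (\<sqinter>) a c"
    using natural_ge_trans[OF _ _ _ ab' b'c] a b' c AB.inA AB.inB BC.inB by blast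
  let ?d = "a \<sqinter> b \<sqinter> a"
  have "midpoint (\<sqinter>) B a c b'" using a b' c ab' b'c by (simp add: midpoint_iff)
  then have "c \<squnion> ?d \<squnion> c = b'"
    using assms midpoint_join[OF a b c ac] a c ac unfolding unique_midpoints_def by blast
  moreover have "c \<squnion> b' \<squnion> c = b'"
    using b'c BC.natural_ge_iff_join[OF b' c] by simp
  moreover have "?d \<in> B" using a b by (simp add: AB.meet_AB AB.meet_BA)
  ultimately have "?d \<in> join_coset (\<squnion>) C b'"
    using BC.join_coset_iff[OF c b'] by simp
  then show "meet_coset (\<sqinter>) A b \<inter> join_coset (\<squnion>) C b' \<noteq> {}"
    using AB.meet_in_coset[OF a b] by blast
qed

text \<open>
  If \<open>a' = c1 \<squnion> a \<squnion> c2\<close>, then \<open>b' = c1 \<squnion> b \<squnion> c2\<close> is an element of the right \<open>C\<close>-coset below \<open>a'\<close>, but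
  perhaps not in the \<open>A\<close>-coset of \<open>b\<close>. Take \<open>c\<close> below \<open>b'\<close>. Then \<open>b'\<close> is the only midpoint of \<open>a'\<close>
  and \<open>c\<close>, so raising \<open>a' \<sqinter> b \<sqinter> a'\<close> past \<open>c\<close> must give \<open>b'\<close>, and raising stays within a \<open>C\<close>-coset.
\<close>

lemma descent_respects_cosets_if_unique_midpoints:
  assumes unique_midpoints
  shows descent_respects_cosets
  unfolding descent_respects_cosets_def
proof (intro ballI impI)
  fix a b a' assume a: "a \<in> A" and b: "b \<in> B" and ab: "natural_ge (\<sqinter>) a b"
    and "a' \<in> join_coset (\<squnion>) C a"
  then obtain c1 c2 where c: "c1 \<in> C" "c2 \<in> C" and a'_eq: "a' = c1 \<squnion> a \<squnion> c2"
    by (auto simp: join_coset_def)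
  have a': "a' \<in> A" using a c by (simp add: a'_eq AC.join_AB AC.join_BA)
  define b' where "b' = c1 \<squnion> b \<squnion> c2"
  have b'_coset: "b' \<in> join_coset (\<squnion>) C b" using c by (auto simp: b'_def join_coset_def)
  have b': "b' \<in> B" using b'_coset b BC.join_coset_subset by blast
  have ab': "natural_ge (\<sqinter>) a' b'"
    unfolding a'_eq b'_def using a b c ab by (rule translate_up_mono)
  define c where "c = b' \<sqinter> c1 \<sqinter> b'"
  have cC: "c \<in> C" and b'c: "natural_ge (\<sqinter>) b' c"
    using c b' BC.natural_ge_meet by (auto simp: c_def BC.meet_AB BC.meet_BA)
  have ac: "natural_ge (\<sqinter>) a' c"
    using natural_ge_trans[OF _ _ _ ab' b'c] a' b' cC AB.inA AB.inB BC.inB by blast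
  have "midpoint (\<sqinter>) B a' c b'" using a' b' cC ab' b'c by (simp add: midpoint_iff)
  then have "c \<squnion> (a' \<sqinter> b \<sqinter> a') \<squnion> c = b'"
    using assms midpoint_join[OF a' b cC ac] a' cC ac unfolding unique_midpoints_def by blast
  moreover have "c \<squnion> b' \<squnion> c = b'"
    using b'c BC.natural_ge_iff_join[OF b' cC] by simp
  moreover have "a' \<sqinter> b \<sqinter> a' \<in> B" using a' b by (simp add: AB.meet_AB AB.meet_BA)
  ultimately have "a' \<sqinter> b \<sqinter> a' \<in> join_coset (\<squnion>) C b'"
    using BC.join_coset_iff[OF cC b'] by simp
  then show "a' \<sqinter> b \<sqinter> a' \<in> join_coset (\<squnion>) C b"
    using BC.join_coset_eq[OF b b'_coset] by simp
qed

text \<open>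
  Let \<open>b\<close> and \<open>b'\<close> be midpoints of \<open>a\<close> and \<open>c\<close>. An element \<open>c1 \<squnion> b' \<squnion> c2\<close> of the \<open>A\<close>-coset of \<open>b\<close>
  lies below \<open>c1 \<squnion> a \<squnion> c2\<close>, so it is the image of \<open>c1 \<squnion> a \<squnion> c2\<close> in that coset and therefore belongs to
  the \<open>C\<close>-coset of \<open>b\<close>. So \<open>b\<close> and \<open>b'\<close> share a \<open>C\<close>-coset, in which only one element is above \<open>c\<close>.
\<close>

lemma unique_midpoints_if_strict:
  assumes inter: cosets_intersect and desc: descent_respects_cosets
  shows unique_midpoints
  unfolding unique_midpoints_def
proof (intro ballI impI ex_ex1I)
  fix a c assume a: "a \<in> A" and c: "c \<in> C" and ac: "natural_ge (\<sqinter>) a c"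
  show "\<exists>b. midpoint (\<sqinter>) B a c b" using midpoint_meet[OF a _ c ac] AB.B_ne by blast
  fix b b' assume "midpoint (\<sqinter>) B a c b" "midpoint (\<sqinter>) B a c b'"
  then have b: "b \<in> B" "natural_ge (\<sqinter>) a b" "natural_ge (\<sqinter>) b c"
    and b': "b' \<in> B" "natural_ge (\<sqinter>) a b'" "natural_ge (\<sqinter>) b' c"
    using a c by (auto simp: midpoint_iff)
  obtain d where dA: "d \<in> meet_coset (\<sqinter>) A b" and dC: "d \<in> join_coset (\<squnion>) C b'"
    using inter b b' unfolding cosets_intersect_def by blast
  then obtain c1 c2 where c12: "c1 \<in> C" "c2 \<in> C" and d: "d = c1 \<squnion> b' \<squnion> c2"
    by (auto simp: join_coset_def)
  define a' where "a' = c1 \<squnion> a \<squnion> c2"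
  have a'_coset: "a' \<in> join_coset (\<squnion>) C a" using c12 by (auto simp: a'_def join_coset_def)
  have a': "a' \<in> A" using a'_coset a AC.join_coset_subset by blast
  have "natural_ge (\<sqinter>) a' d"
    unfolding a'_def d using a b' c12 by (intro translate_up_mono) auto
  then have "d = a' \<sqinter> b \<sqinter> a'"
    using dA AB.below_in_coset_iff[OF a' b(1)] by blast
  then have "d \<in> join_coset (\<squnion>) C b"
    using desc a b a'_coset unfolding descent_respects_cosets_def by blast
  then have "join_coset (\<squnion>) C b = join_coset (\<squnion>) C b'"
    using dC BC.join_coset_eq b b' by metis
  then have "b' \<in> join_coset (\<squnion>) C b" using BC.join_coset_self b' by blast
  then show "b = b'"
    using BC.above_in_coset_iff[OF b(1) c] BC.join_coset_self[OF b(1)] b b' by metis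
qed

text \<open>
  The composite is always a restriction of the direct bijection: an element \<open>x\<close> whose image is
  \<open>c1 \<squnion> b \<squnion> c2\<close> is itself \<open>c1 \<squnion> a \<squnion> c2\<close>, and the two values at \<open>x\<close> agree by regularity. So equality
  depends only on the domains.
\<close>

lemma coset_map_comp:
  assumes a: "a \<in> A" and b: "b \<in> B" and c: "c \<in> C"
    and ab: "natural_ge (\<sqinter>) a b" and bc: "natural_ge (\<sqinter>) b c"
  shows "coset_map (\<sqinter>) (\<squnion>) C b c \<circ>\<^sub>m coset_map (\<sqinter>) (\<squnion>) B a b = coset_map (\<sqinter>) (\<squnion>) C a c
    \<longleftrightarrow> (\<forall>a'\<in>join_coset (\<squnion>) C a. a' \<sqinter> b \<sqinter> a' \<in> join_coset (\<squnion>) C b)"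
proof -
  let ?comp = "coset_map (\<sqinter>) (\<squnion>) C b c \<circ>\<^sub>m coset_map (\<sqinter>) (\<squnion>) B a b"
  let ?direct = "coset_map (\<sqinter>) (\<squnion>) C a c"
  have ba: "b \<squnion> a \<squnion> b = a" using a b ab AB.natural_ge_iff_join by blast
  have sub: "join_coset (\<squnion>) C a \<subseteq> join_coset (\<squnion>) B a"
  proof
    fix x assume "x \<in> join_coset (\<squnion>) C a"
    then obtain c1 c2 where c12: "c1 \<in> C" "c2 \<in> C" and x: "x = c1 \<squnion> a \<squnion> c2"
      by (auto simp: join_coset_def)
    have "x = c1 \<squnion> (b \<squnion> a \<squnion> b) \<squnion> c2"
      unfolding ba x ..
    also have "\<dots> = (c1 \<squnion> b) \<squnion> a \<squnion> (b \<squnion> c2)"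
      using c12 a b by (simp add: join_assoc join_closed AB.inA AB.inB BC.inB)
    finally show "x \<in> join_coset (\<squnion>) B a"
      using c12 b unfolding join_coset_def by (blast intro: BC.join_AB BC.join_BA)
  qed
  have val: "?comp x = ?direct x"
    if x: "x \<in> join_coset (\<squnion>) B a" and xb: "x \<sqinter> b \<sqinter> x \<in> join_coset (\<squnion>) C b" for x
  proof -
    have xA: "x \<in> A" using x a AB.join_coset_subset by blast
    note [simp] = AB.inA[OF a] AB.inB[OF b] BC.inB[OF c] AB.inA[OF xA] meet_closed join_closed
    let ?y = "x \<sqinter> b \<sqinter> x"
    obtain c1 c2 where c12: "c1 \<in> C" "c2 \<in> C" and y: "?y = c1 \<squnion> b \<squnion> c2"
      using xb by (auto simp: join_coset_def)
    note [simp] = c12[THEN BC.inB]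
    have yB: "?y \<in> B" using xA b by (simp add: AB.meet_AB AB.meet_BA)
    have b1: "b \<squnion> c2 \<squnion> b = b" "b \<squnion> c1 \<squnion> b = b"
      using b c12 by (simp_all add: BC.A_above_B)
    have "natural_ge (\<sqinter>) x ?y" using xA b by (rule AB.natural_ge_meet)
    then have "x = ?y \<squnion> a \<squnion> ?y"
      using AB.above_in_coset_iff[OF a yB] x by blast
    also have "\<dots> = c1 \<squnion> b \<squnion> c2 \<squnion> (b \<squnion> a \<squnion> b) \<squnion> (c1 \<squnion> b \<squnion> c2)"
      unfolding y ba ..
    also have "\<dots> = c1 \<squnion> (b \<squnion> c2 \<squnion> b) \<squnion> a \<squnion> (b \<squnion> c1 \<squnion> b) \<squnion> c2"
      by (simp add: join_assoc)
    also have "\<dots> = c1 \<squnion> (b \<squnion> a \<squnion> b) \<squnion> c2"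
      unfolding b1 by (simp add: join_assoc)
    finally have x': "x \<in> join_coset (\<squnion>) C a"
      unfolding ba join_coset_def using c12 by blast
    have bcb: "b \<sqinter> c \<sqinter> b = c" using bc BC.natural_ge_iff[OF b c] by blast
    have "?y \<sqinter> c \<sqinter> ?y = (x \<sqinter> b \<sqinter> x \<sqinter> c \<sqinter> x) \<sqinter> b \<sqinter> x"
      by (simp add: meet_assoc)
    also have "\<dots> = x \<sqinter> (b \<sqinter> c) \<sqinter> x \<sqinter> b \<sqinter> x"
      by (subst meet_regular) (simp_all add: meet_assoc)
    also have "\<dots> = x \<sqinter> (b \<sqinter> c) \<sqinter> b \<sqinter> x"
      by (subst meet_regular) simp_all
    also have "\<dots> = x \<sqinter> c \<sqinter> x"
      using bcb by (simp add: meet_assoc)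
    finally have "?y \<sqinter> c \<sqinter> ?y = x \<sqinter> c \<sqinter> x" .
    then show ?thesis
      using x xb x' by (simp add: coset_map_def map_comp_def)
  qed
  show ?thesis
  proof
    assume eq: "?comp = ?direct"
    show "\<forall>a'\<in>join_coset (\<squnion>) C a. a' \<sqinter> b \<sqinter> a' \<in> join_coset (\<squnion>) C b"
    proof
      fix x assume x: "x \<in> join_coset (\<squnion>) C a"
      then have "?comp x \<noteq> None" unfolding eq by (simp add: coset_map_def)
      then show "x \<sqinter> b \<sqinter> x \<in> join_coset (\<squnion>) C b"
        by (auto simp: coset_map_def map_comp_def split: if_splits)
    qed
  next
    assume desc: "\<forall>a'\<in>join_coset (\<squnion>) C a. a' \<sqinter> b \<sqinter> a' \<in> join_coset (\<squnion>) C b"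
    show "?comp = ?direct"
    proof
      fix x
      show "?comp x = ?direct x"
      proof (cases "x \<in> join_coset (\<squnion>) B a \<and> x \<sqinter> b \<sqinter> x \<in> join_coset (\<squnion>) C b")
        case True
        then show ?thesis using val by blast
      next
        case False
        then have "?comp x = None" by (auto simp: coset_map_def map_comp_def)
        moreover have "x \<notin> join_coset (\<squnion>) C a" using False desc sub by blast
        ultimately show ?thesis by (simp add: coset_map_def)
      qed
    qed
  qed
qed

definition composites_are_coset_bijections :: bool where
  "composites_are_coset_bijections \<longleftrightarrow>
    (\<forall>\<phi> \<psi>. coset_bijection (\<sqinter>) (\<squnion>) A B \<phi> \<longrightarrow> coset_bijection (\<sqinter>) (\<squnion>) B C \<psi> \<longrightarrow>
      \<psi> \<circ>\<^sub>m \<phi> \<noteq> Map.empty \<longrightarrow> coset_bijection (\<sqinter>) (\<squnion>) A C (\<psi> \<circ>\<^sub>m \<phi>))"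

lemma coset_bijection_through:
  "\<lbrakk>coset_bijection (\<sqinter>) (\<squnion>) A B \<phi>; \<phi> a = Some b\<rbrakk> \<Longrightarrow>
    a \<in> A \<and> b \<in> B \<and> natural_ge (\<sqinter>) a b \<and> \<phi> = coset_map (\<sqinter>) (\<squnion>) B a b"
  using AB.coset_map_Some AB.coset_bijection_iff_coset_map by metis

text \<open>
  A nonempty composite contains some pair \<open>(a, c)\<close> that passes through an element \<open>b\<close>. If it is a
  coset bijection at all, it is the one determined by \<open>(a, c)\<close>, and the description of composites by
  domains applies.
\<close>

lemma composites_iff_descent_respects_cosets:
  "composites_are_coset_bijections \<longleftrightarrow> descent_respects_cosets"
proof
  assume comp: composites_are_coset_bijections
  show descent_respects_cosets
    unfolding descent_respects_cosets_def
  proof (intro ballI impI)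
    fix a b a' assume a: "a \<in> A" and b: "b \<in> B" and ab: "natural_ge (\<sqinter>) a b"
      and a': "a' \<in> join_coset (\<squnion>) C a"
    obtain c0 where c0: "c0 \<in> C" using BC.B_ne by blast
    define c where "c = b \<sqinter> c0 \<sqinter> b"
    have c: "c \<in> C" and bc: "natural_ge (\<sqinter>) b c"
      using c0 b BC.natural_ge_meet by (auto simp: c_def BC.meet_AB BC.meet_BA)
    let ?\<phi> = "coset_map (\<sqinter>) (\<squnion>) B a b" and ?\<psi> = "coset_map (\<sqinter>) (\<squnion>) C b c"
    have ac: "(?\<psi> \<circ>\<^sub>m ?\<phi>) a = Some c"
      using AB.coset_map_self[OF a b ab] BC.coset_map_self[OF b c bc] by simp
    then have "?\<psi> \<circ>\<^sub>m ?\<phi> \<noteq> Map.empty" by (metis option.distinct(1))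
    then have "coset_bijection (\<sqinter>) (\<squnion>) A C (?\<psi> \<circ>\<^sub>m ?\<phi>)"
      using comp a b c AB.coset_bijection_iff_coset_map BC.coset_bijection_iff_coset_map
      unfolding composites_are_coset_bijections_def by blast
    then have "?\<psi> \<circ>\<^sub>m ?\<phi> = coset_map (\<sqinter>) (\<squnion>) C a c"
      using ac AC.coset_map_Some(4) AC.coset_bijection_iff_coset_map by metis
    then show "a' \<sqinter> b \<sqinter> a' \<in> join_coset (\<squnion>) C b"
      using coset_map_comp[OF a b c ab bc] a' by blast
  qed
next
  assume desc: descent_respects_cosets
  show composites_are_coset_bijections
    unfolding composites_are_coset_bijections_def
  proof (intro allI impI)
    fix \<phi> \<psi> assume \<phi>: "coset_bijection (\<sqinter>) (\<squnion>) A B \<phi>" and \<psi>: "coset_bijection (\<sqinter>) (\<squnion>) B C \<psi>"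
      and "\<psi> \<circ>\<^sub>m \<phi> \<noteq> Map.empty"
    then obtain a b c where ab: "\<phi> a = Some b" and bc: "\<psi> b = Some c"
      by (auto simp: fun_eq_iff map_comp_def split: option.splits)
    note 1 = coset_bijection_through[OF \<phi> ab]
    have 2: "c \<in> C \<and> natural_ge (\<sqinter>) b c \<and> \<psi> = coset_map (\<sqinter>) (\<squnion>) C b c"
      using \<psi> bc BC.coset_map_Some BC.coset_bijection_iff_coset_map by metis
    have "\<psi> \<circ>\<^sub>m \<phi> = coset_map (\<sqinter>) (\<squnion>) C a c"
      using 1 2 coset_map_comp[of a b c] desc unfolding descent_respects_cosets_def by blast
    then show "coset_bijection (\<sqinter>) (\<squnion>) A C (\<psi> \<circ>\<^sub>m \<phi>)"
      using 1 2 AC.coset_bijection_iff_coset_map by blast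
  qed
qed

lemma unique_midpoints_iff:
  "unique_midpoints \<longleftrightarrow> composites_are_coset_bijections \<and> cosets_intersect"
  using unique_midpoints_if_strict cosets_intersect_if_unique_midpoints
    descent_respects_cosets_if_unique_midpoints composites_iff_descent_respects_cosets by blast

text \<open>
  If \<open>(a, c)\<close> is in the graph of \<open>\<chi>\<close>, both factors of \<open>\<chi>\<close> are determined by the element through which
  they send \<open>a\<close> to \<open>c\<close>, and this element must be the midpoint of \<open>a\<close> and \<open>c\<close>.
\<close>

lemma unique_factorization:
  assumes um: unique_midpoints and \<chi>: "coset_bijection (\<sqinter>) (\<squnion>) A C \<chi>"
  shows "\<exists>!(\<phi>, \<psi>). coset_bijection (\<sqinter>) (\<squnion>) A B \<phi> \<and> coset_bijection (\<sqinter>) (\<squnion>) B C \<psi> \<and> \<chi> = \<psi> \<circ>\<^sub>m \<phi>"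
proof -
  have desc: descent_respects_cosets
    using um by (rule descent_respects_cosets_if_unique_midpoints)
  obtain a c0 where a: "a \<in> A" and c0: "c0 \<in> C" and "\<chi> = coset_map (\<sqinter>) (\<squnion>) C a c0"
    using \<chi> AC.coset_bijection_iff_coset_map by blast
  then have \<chi>a: "coset_map (\<sqinter>) (\<squnion>) C a c0 a = Some (a \<sqinter> c0 \<sqinter> a)"
    using AC.join_coset_self[OF a] by (simp add: coset_map_def)
  define c where "c = a \<sqinter> c0 \<sqinter> a"
  note * = AC.coset_map_Some[OF a c0 \<chi>a, folded c_def]
  have c: "c \<in> C" and ac: "natural_ge (\<sqinter>) a c" and \<chi>_eq: "\<chi> = coset_map (\<sqinter>) (\<squnion>) C a c"
    using * \<open>\<chi> = _\<close> by auto
  obtain b where mid: "midpoint (\<sqinter>) B a c b"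
    and uniq: "\<And>b'. midpoint (\<sqinter>) B a c b' \<Longrightarrow> b' = b"
    using um a c ac unfolding unique_midpoints_def by blast
  have b: "b \<in> B" and ab: "natural_ge (\<sqinter>) a b" and bc: "natural_ge (\<sqinter>) b c"
    using mid a c by (auto simp: midpoint_iff)
  let ?\<phi> = "coset_map (\<sqinter>) (\<squnion>) B a b" and ?\<psi> = "coset_map (\<sqinter>) (\<squnion>) C b c"
  show ?thesis
  proof (intro ex1I[of _ "(?\<phi>, ?\<psi>)"])
    have "\<chi> = ?\<psi> \<circ>\<^sub>m ?\<phi>"
      using coset_map_comp[OF a b c ab bc] desc a b ab
      unfolding \<chi>_eq descent_respects_cosets_def by auto
    then show "case (?\<phi>, ?\<psi>) of (\<phi>, \<psi>) \<Rightarrow>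
        coset_bijection (\<sqinter>) (\<squnion>) A B \<phi> \<and> coset_bijection (\<sqinter>) (\<squnion>) B C \<psi> \<and> \<chi> = \<psi> \<circ>\<^sub>m \<phi>"
      using a b c AB.coset_bijection_iff_coset_map BC.coset_bijection_iff_coset_map by auto
  next
    fix p assume p: "case p of (\<phi>, \<psi>) \<Rightarrow>
        coset_bijection (\<sqinter>) (\<squnion>) A B \<phi> \<and> coset_bijection (\<sqinter>) (\<squnion>) B C \<psi> \<and> \<chi> = \<psi> \<circ>\<^sub>m \<phi>"
    obtain \<phi> \<psi> where p_eq: "p = (\<phi>, \<psi>)" by (cases p)
    have \<phi>: "coset_bijection (\<sqinter>) (\<squnion>) A B \<phi>" and \<psi>: "coset_bijection (\<sqinter>) (\<squnion>) B C \<psi>"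
      and \<chi>_comp: "\<chi> = \<psi> \<circ>\<^sub>m \<phi>" using p p_eq by auto
    have "(\<psi> \<circ>\<^sub>m \<phi>) a = Some c"
      unfolding \<chi>_comp[symmetric] \<chi>_eq by (rule AC.coset_map_self[OF a c ac])
    then obtain b' where ab': "\<phi> a = Some b'" and bc': "\<psi> b' = Some c"
      by (auto simp: map_comp_def split: option.splits)
    note 1 = coset_bijection_through[OF \<phi> ab']
    have 2: "natural_ge (\<sqinter>) b' c \<and> \<psi> = coset_map (\<sqinter>) (\<squnion>) C b' c"
      using \<psi> bc' BC.coset_map_Some BC.coset_bijection_iff_coset_map by metis
    have "b' = b" using uniq 1 2 midpoint_iff[OF a c] by blast
    then show "p = (?\<phi>, ?\<psi>)" using 1 2 p_eq by simp
  qed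
qed

end

section \<open>Distributivity from the median law\<close>

context skew_lattice
begin

text \<open>
  If \<open>x\<close> lies below \<open>y\<close> or below \<open>z\<close> in the natural preorder, both sides are \<open>x\<close>.
\<close>

lemma meet_distrib_trivial:
  assumes S: "x \<in> S" "y \<in> S" "z \<in> S"
    and "x \<sqinter> y \<sqinter> x = x \<or> x \<sqinter> z \<sqinter> x = x"
  shows "x \<sqinter> (y \<squnion> z) \<sqinter> x = (x \<sqinter> y \<sqinter> x) \<squnion> (x \<sqinter> z \<sqinter> x)"
proof -
  have yz: "y \<squnion> z \<in> S" using S by (simp add: join_closed)
  have below_y: "y \<sqinter> (y \<squnion> z) \<sqinter> y = y"
    using S by (simp add: meet_join_absorb meet_idem)
  have below_z: "z \<sqinter> (y \<squnion> z) \<sqinter> z = z"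
    using S yz by (simp add: meet_assoc join_meet_absorb_right meet_idem)
  have "x \<sqinter> (y \<squnion> z) \<sqinter> x = x"
    using assms(4) meet_absorb_trans[OF S(1,2) yz _ below_y] meet_absorb_trans[OF S(1,3) yz _ below_z]
    by blast
  moreover have "(x \<sqinter> y \<sqinter> x) \<squnion> (x \<sqinter> z \<sqinter> x) = x"
    using assms(4) S join_meet_absorb[of x "z \<sqinter> x"] meet_join_absorb_right[of x "x \<sqinter> y"]
    by (auto simp: meet_assoc meet_closed)
  ultimately show ?thesis by simp
qed

end

context class_pair
begin

lemma meet_distrib_lower:
  assumes x: "x \<in> A" and yz: "y \<in> B" "z \<in> B"
  shows "x \<sqinter> (y \<squnion> z) \<sqinter> x = (x \<sqinter> y \<sqinter> x) \<squnion> (x \<sqinter> z \<sqinter> x)"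
proof -
  have "x \<sqinter> y \<sqinter> x \<in> B" "x \<sqinter> z \<sqinter> x \<in> B"
    using x yz by (simp_all add: meet_AB meet_BA)
  then show ?thesis
    using x yz by (simp add: join_eq_flipped_meet_B meet_meet_cong)
qed

end

context class_triple
begin

text \<open>
  Raising \<open>b\<close> past \<open>c\<close> and lowering it below \<open>a\<close> commute. The law is its own dual.
\<close>

definition median_law :: bool where
  "median_law \<longleftrightarrow> (\<forall>a\<in>A. \<forall>b\<in>B. \<forall>c\<in>C. natural_ge (\<sqinter>) a c \<longrightarrow>
    a \<sqinter> (c \<squnion> b \<squnion> c) \<sqinter> a = c \<squnion> (a \<sqinter> b \<sqinter> a) \<squnion> c)"

lemma dual_median_law:
  assumes median_law
  shows "class_triple.median_law (\<squnion>) (\<sqinter>) C B A"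
  unfolding class_triple.median_law_def[OF dual_triple]
  using assms natural_ge_dual AB.inA BC.inB unfolding median_law_def by metis

text \<open>
  The law also describes the result for \<open>c\<close> not below \<open>a\<close>, with \<open>c\<close> replaced by its image
  \<open>c' = a \<sqinter> c \<sqinter> a\<close>. Let \<open>d = c \<squnion> b \<squnion> c\<close>, which is above \<open>c\<close>. The image \<open>a \<sqinter> d \<sqinter> a\<close> is above \<open>c'\<close>, so
  raising it past \<open>c'\<close> has no effect; by the law, it is also the image of \<open>c' \<squnion> d \<squnion> c'\<close> below \<open>a\<close>.
  There the two \<open>c\<close> inside \<open>d\<close> are absorbed by \<open>c'\<close>, which leaves \<open>c' \<squnion> b \<squnion> c'\<close>, and a second
  application of the law with \<open>b\<close> in the place of \<open>d\<close> yields the claim.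
\<close>

lemma median_law_all:
  assumes ml: median_law and a: "a \<in> A" and b: "b \<in> B" and c: "c \<in> C"
  shows "a \<sqinter> (c \<squnion> b \<squnion> c) \<sqinter> a = (a \<sqinter> c \<sqinter> a) \<squnion> (a \<sqinter> b \<sqinter> a) \<squnion> (a \<sqinter> c \<sqinter> a)"
proof -
  define c' where "c' = a \<sqinter> c \<sqinter> a"
  define d where "d = c \<squnion> b \<squnion> c"
  have c': "c' \<in> C" and ac': "natural_ge (\<sqinter>) a c'"
    using a c AC.natural_ge_meet by (auto simp: c'_def AC.meet_AB AC.meet_BA)
  have d: "d \<in> B" and dc: "natural_ge (\<sqinter>) d c"
    using b c BC.natural_ge_join by (auto simp: d_def BC.join_AB BC.join_BA)
  let ?e = "a \<sqinter> d \<sqinter> a"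
  have e: "?e \<in> B" using a d by (simp add: AB.meet_AB AB.meet_BA)
  note [simp] = AB.inA[OF a] AB.inB[OF b] BC.inB[OF c] BC.inB[OF c'] AB.inB[OF d]
    meet_closed join_closed
  have "?e \<sqinter> c' = a \<sqinter> d \<sqinter> a \<sqinter> c \<sqinter> a"
    by (simp add: c'_def meet_assoc meet_left_idem)
  also have "\<dots> = a \<sqinter> d \<sqinter> c \<sqinter> a"
    by (rule meet_regular) simp_all
  also have "\<dots> = c'"
    using dc by (simp add: c'_def natural_ge_def meet_assoc)
  finally have ec': "?e \<sqinter> c' = c'" .
  have "c' \<sqinter> ?e = a \<sqinter> c \<sqinter> a \<sqinter> d \<sqinter> a"
    by (simp add: c'_def meet_assoc meet_left_idem)
  also have "\<dots> = a \<sqinter> c \<sqinter> d \<sqinter> a"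
    by (rule meet_regular) simp_all
  also have "\<dots> = c'"
    using dc by (simp add: c'_def natural_ge_def meet_assoc)
  finally have ge: "natural_ge (\<sqinter>) ?e c'"
    using ec' by (simp add: natural_ge_def)
  have c'cc': "c' \<squnion> c \<squnion> c' = c'" using c c' by (simp add: BC.join_rect_B)
  have "c' \<squnion> d \<squnion> c' = c' \<squnion> c \<squnion> b \<squnion> c \<squnion> c'"
    by (simp add: d_def join_assoc)
  also have "\<dots> = c' \<squnion> c \<squnion> (b \<squnion> c) \<squnion> c'"
    by (simp add: join_assoc)
  also have "\<dots> = c' \<squnion> c \<squnion> c' \<squnion> (b \<squnion> c) \<squnion> c'"
    by (rule join_regular[symmetric]) simp_all
  also have "\<dots> = c' \<squnion> b \<squnion> c \<squnion> c'"
    unfolding c'cc' by (simp add: join_assoc)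
  also have "\<dots> = c' \<squnion> b \<squnion> c' \<squnion> c \<squnion> c'"
    by (rule join_regular[symmetric]) simp_all
  also have "\<dots> = c' \<squnion> b \<squnion> c'"
    using c'cc' by (simp add: join_assoc)
  finally have c'dc': "c' \<squnion> d \<squnion> c' = c' \<squnion> b \<squnion> c'" .
  have "?e = c' \<squnion> ?e \<squnion> c'"
    using BC.natural_ge_iff_join[OF e c'] ge by simp
  also have "\<dots> = a \<sqinter> (c' \<squnion> d \<squnion> c') \<sqinter> a"
    using ml a d c' ac' unfolding median_law_def by simp
  also have "\<dots> = a \<sqinter> (c' \<squnion> b \<squnion> c') \<sqinter> a"
    unfolding c'dc' ..
  also have "\<dots> = c' \<squnion> (a \<sqinter> b \<sqinter> a) \<squnion> c'"
    using ml a b c' ac' unfolding median_law_def by simp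
  finally show ?thesis
    by (simp only: c'_def d_def)
qed

text \<open>
  On \<open>B\<close> the join is the meet with flipped arguments. So \<open>b \<squnion> c\<close>, which is the join of \<open>b\<close> and
  \<open>c \<squnion> b \<squnion> c\<close>, is a meet of these two elements, and taking the images below \<open>a\<close> respects meets.
\<close>

lemma meet_distrib_mixed:
  assumes ml: median_law and a: "a \<in> A" and b: "b \<in> B" and c: "c \<in> C"
  shows "a \<sqinter> (b \<squnion> c) \<sqinter> a = (a \<sqinter> b \<sqinter> a) \<squnion> (a \<sqinter> c \<sqinter> a)" (is ?bc)
    and "a \<sqinter> (c \<squnion> b) \<sqinter> a = (a \<sqinter> c \<sqinter> a) \<squnion> (a \<sqinter> b \<sqinter> a)" (is ?cb)
proof -
  define b' where "b' = a \<sqinter> b \<sqinter> a"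
  define c' where "c' = a \<sqinter> c \<sqinter> a"
  define d where "d = c \<squnion> b \<squnion> c"
  have b': "b' \<in> B" and c': "c' \<in> C" and d: "d \<in> B"
    using a b c by (auto simp: b'_def c'_def d_def AB.meet_AB AB.meet_BA AC.meet_AB AC.meet_BA
      BC.join_AB BC.join_BA)
  note [simp] = AB.inA[OF a] AB.inB[OF b] BC.inB[OF c] AB.inB[OF b'] BC.inB[OF c']
    meet_closed join_closed
  have d': "a \<sqinter> d \<sqinter> a = c' \<squnion> b' \<squnion> c'"
    using median_law_all[OF assms] by (simp only: b'_def c'_def d_def)
  have d'B: "c' \<squnion> b' \<squnion> c' \<in> B" using b' c' by (simp add: BC.join_AB BC.join_BA)
  have bcb: "b \<squnion> c \<squnion> b = b" "b' \<squnion> c' \<squnion> b' = b'"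
    using b c b' c' by (simp_all add: BC.A_above_B)
  have bd: "b \<squnion> c = d \<sqinter> b"
  proof -
    have "d \<sqinter> b = b \<squnion> d" using b d by (simp add: AB.join_eq_flipped_meet_B)
    also have "\<dots> = (b \<squnion> c \<squnion> b) \<squnion> c" by (simp add: d_def join_assoc)
    finally show ?thesis by (simp add: bcb)
  qed
  have "a \<sqinter> (b \<squnion> c) \<sqinter> a = (c' \<squnion> b' \<squnion> c') \<sqinter> b'"
    unfolding bd AB.meet_meet_cong[OF a d b] d' b'_def ..
  also have "\<dots> = b' \<squnion> (c' \<squnion> b' \<squnion> c')"
    using b' d'B by (simp add: AB.join_eq_flipped_meet_B)
  also have "\<dots> = (b' \<squnion> c' \<squnion> b') \<squnion> c'"
    by (simp add: join_assoc)
  finally show ?bc unfolding bcb(2) unfolding b'_def c'_def .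
  have db: "c \<squnion> b = b \<sqinter> d"
  proof -
    have "b \<sqinter> d = d \<squnion> b" using b d by (simp add: AB.join_eq_flipped_meet_B)
    also have "\<dots> = c \<squnion> (b \<squnion> c \<squnion> b)" by (simp add: d_def join_assoc)
    finally show ?thesis by (simp add: bcb)
  qed
  have "a \<sqinter> (c \<squnion> b) \<sqinter> a = b' \<sqinter> (c' \<squnion> b' \<squnion> c')"
    unfolding db AB.meet_meet_cong[OF a b d] d' b'_def ..
  also have "\<dots> = (c' \<squnion> b' \<squnion> c') \<squnion> b'"
    using b' d'B by (simp add: AB.join_eq_flipped_meet_B)
  also have "\<dots> = c' \<squnion> (b' \<squnion> c' \<squnion> b')"
    by (simp add: join_assoc)
  finally show ?cb unfolding bcb(2) unfolding b'_def c'_def .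
qed

lemma meet_distrib_if_median_law:
  assumes ml: median_law and S: "S = A \<union> B \<union> C" and xyz: "x \<in> S" "y \<in> S" "z \<in> S"
  shows "x \<sqinter> (y \<squnion> z) \<sqinter> x = (x \<sqinter> y \<sqinter> x) \<squnion> (x \<sqinter> z \<sqinter> x)"
proof -
  have "x \<sqinter> w \<sqinter> x = x \<or> x \<in> A \<and> w \<in> B \<or> x \<in> A \<and> w \<in> C \<or> x \<in> B \<and> w \<in> C" if "w \<in> S" for w
    using that xyz(1) unfolding S
    using AB.rect_A AB.rect_B BC.rect_B AB.B_below_A AC.B_below_A BC.B_below_A by blast
  from this[OF xyz(2)] this[OF xyz(3)]
  consider "x \<sqinter> y \<sqinter> x = x \<or> x \<sqinter> z \<sqinter> x = x" | "x \<in> A" "y \<in> B" "z \<in> B"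
    | "x \<in> A" "y \<in> C" "z \<in> C" | "x \<in> B" "y \<in> C" "z \<in> C" | "x \<in> A" "y \<in> B" "z \<in> C"
    | "x \<in> A" "y \<in> C" "z \<in> B"
    using AB.disjoint AC.disjoint by blast
  then show ?thesis
  proof cases
    case 1 then show ?thesis using meet_distrib_trivial xyz by blast
  next
    case 2 then show ?thesis by (rule AB.meet_distrib_lower)
  next
    case 3 then show ?thesis by (rule AC.meet_distrib_lower)
  next
    case 4 then show ?thesis by (rule BC.meet_distrib_lower)
  next
    case 5 then show ?thesis by (rule meet_distrib_mixed(1)[OF ml])
  next
    case 6 then show ?thesis using meet_distrib_mixed(2)[OF ml] by blast
  qed
qed

lemma distributive_iff_median_law:
  assumes S: "S = A \<union> B \<union> C"
  shows "distributive_skew_lattice S (\<sqinter>) (\<squnion>) \<longleftrightarrow> median_law"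
proof
  assume ml: median_law
  have "S = C \<union> B \<union> A" using S by blast
  note dual_distrib =
    class_triple.meet_distrib_if_median_law[OF dual_triple dual_median_law[OF ml] this]
  show "distributive_skew_lattice S (\<sqinter>) (\<squnion>)"
    by unfold_locales (fact meet_distrib_if_median_law[OF ml S], fact dual_distrib)
next
  assume "distributive_skew_lattice S (\<sqinter>) (\<squnion>)"
  then interpret d: distributive_skew_lattice S "(\<sqinter>)" "(\<squnion>)" .
  show median_law
    unfolding median_law_def
  proof (intro ballI impI)
    fix a b c assume abc: "a \<in> A" "b \<in> B" "c \<in> C" and "natural_ge (\<sqinter>) a c"
    then have "a \<sqinter> c \<sqinter> a = c" using AC.natural_ge_iff by blast
    then show "a \<sqinter> (c \<squnion> b \<squnion> c) \<sqinter> a = c \<squnion> (a \<sqinter> b \<sqinter> a) \<squnion> c"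
      using abc by (simp add: d.meet_distrib join_closed AB.inA AB.inB BC.inB)
  qed
qed

section \<open>Components\<close>

abbreviation step :: "'a rel" where "step \<equiv> AC_step (\<sqinter>) (\<squnion>) A B C"

lemma step_iff:
  "(b, b') \<in> step \<longleftrightarrow>
    b \<in> B \<and> (b' \<in> meet_coset (\<sqinter>) A b \<or> b' \<in> join_coset (\<squnion>) C b)"
proof
  assume "(b, b') \<in> step"
  then consider b0 where "b \<in> B" "b0 \<in> B" "b \<in> meet_coset (\<sqinter>) A b0" "b' \<in> meet_coset (\<sqinter>) A b0"
    | b0 where "b \<in> B" "b0 \<in> B" "b \<in> join_coset (\<squnion>) C b0" "b' \<in> join_coset (\<squnion>) C b0"
    by (auto simp: AC_step_def meet_cosets_def join_cosets_def)
  then show "b \<in> B \<and> (b' \<in> meet_coset (\<sqinter>) A b \<or> b' \<in> join_coset (\<squnion>) C b)"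
    by cases (metis AB.coset_eq, metis BC.join_coset_eq)
next
  assume r: "b \<in> B \<and> (b' \<in> meet_coset (\<sqinter>) A b \<or> b' \<in> join_coset (\<squnion>) C b)"
  have "b' \<in> B" using r AB.coset_subset[of b] BC.join_coset_subset[of b] by auto
  then show "(b, b') \<in> step"
    using r AB.coset_self[of b] BC.join_coset_self[of b]
    by (auto simp: AC_step_def meet_cosets_def join_cosets_def)
qed

text \<open>
  Both kinds of cosets give congruences on \<open>B\<close>. For \<open>C\<close>-cosets this is known for the join by
  duality, which on \<open>B\<close> is the meet with flipped arguments; hence the exchange of sides.
\<close>

lemma step_meet:
  assumes "(b, b') \<in> step" and x: "x \<in> B"
  shows "(b \<sqinter> x, b' \<sqinter> x) \<in> step" and "(x \<sqinter> b, x \<sqinter> b') \<in> step"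
proof -
  interpret CB: class_pair S "(\<squnion>)" "(\<sqinter>)" C B by (rule BC.dual_pair)
  obtain a c where a: "a \<in> A" and c: "c \<in> C" using AB.A_ne BC.B_ne by blast
  have b: "b \<in> B" "b' \<in> B" using assms(1) by (auto simp: AC_step_def)
  have "a \<sqinter> b' \<sqinter> a = a \<sqinter> b \<sqinter> a \<or> c \<squnion> b' \<squnion> c = c \<squnion> b \<squnion> c"
    using assms(1) AB.meet_coset_iff[OF a] BC.join_coset_iff[OF c] by (auto simp: step_iff)
  then have 1: "a \<sqinter> (b' \<sqinter> x) \<sqinter> a = a \<sqinter> (b \<sqinter> x) \<sqinter> a \<or> c \<squnion> (x \<squnion> b') \<squnion> c = c \<squnion> (x \<squnion> b) \<squnion> c"
    and 2: "a \<sqinter> (x \<sqinter> b') \<sqinter> a = a \<sqinter> (x \<sqinter> b) \<sqinter> a \<or> c \<squnion> (b' \<squnion> x) \<squnion> c = c \<squnion> (b \<squnion> x) \<squnion> c"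
    using a b c x AB.meet_meet_cong CB.meet_meet_cong by auto
  show "(b \<sqinter> x, b' \<sqinter> x) \<in> step"
    using 1 a b c x AB.meet_B
    by (auto simp: step_iff AB.meet_coset_iff[OF a] BC.join_coset_iff[OF c] AB.join_eq_flipped_meet_B)
  show "(x \<sqinter> b, x \<sqinter> b') \<in> step"
    using 2 a b c x AB.meet_B
    by (auto simp: step_iff AB.meet_coset_iff[OF a] BC.join_coset_iff[OF c] AB.join_eq_flipped_meet_B)
qed

lemma step_rtrancl_meet:
  assumes "(b, b') \<in> step\<^sup>*" and "x \<in> B"
  shows "(b \<sqinter> x, b' \<sqinter> x) \<in> step\<^sup>*" and "(x \<sqinter> b, x \<sqinter> b') \<in> step\<^sup>*"
  using assms(1) by (induction; meson step_meet assms(2) rtrancl.intros)+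

lemma step_rtrancl_closed: "(b, b') \<in> step\<^sup>* \<Longrightarrow> b \<in> B \<Longrightarrow> b' \<in> B"
  by (erule rtranclE) (auto simp: AC_step_def)

lemma step_rtrancl_sym: "(b, b') \<in> step\<^sup>* \<Longrightarrow> (b', b) \<in> step\<^sup>*"
proof -
  have "sym step" by (auto simp: sym_def AC_step_def)
  then show "(b, b') \<in> step\<^sup>* \<Longrightarrow> (b', b) \<in> step\<^sup>*" by (meson sym_rtrancl symD)
qed

lemma AC_component_iff:
  "AC_component (\<sqinter>) (\<squnion>) A B C X \<longleftrightarrow> (\<exists>b\<in>B. X = step\<^sup>* `` {b})"
proof -
  have conn: "AC_connected_set (\<sqinter>) (\<squnion>) A B C (step\<^sup>* `` {b})" if "b \<in> B" for b
    unfolding AC_connected_set_def AC_connected_def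
    by (auto intro: step_rtrancl_closed[OF _ that]) (meson step_rtrancl_sym rtrancl_trans)
  have below: "Y \<subseteq> step\<^sup>* `` {b}" if "AC_connected_set (\<sqinter>) (\<squnion>) A B C Y" "b \<in> Y" for b Y
    using that unfolding AC_connected_set_def AC_connected_def by auto
  show ?thesis
  proof
    assume X: "AC_component (\<sqinter>) (\<squnion>) A B C X"
    have XB: "AC_connected_set (\<sqinter>) (\<squnion>) A B C X" "X \<subseteq> B"
      using X by (simp_all add: AC_component_def AC_connected_set_def)
    have "X \<noteq> {}"
    proof
      assume "X = {}"
      obtain b where b: "b \<in> B" using AB.B_ne by blast
      then have "step\<^sup>* `` {b} = {}"
        using X conn[OF b] \<open>X = {}\<close> by (auto simp only: AC_component_def)
      then show False by auto
    qed
    then obtain b where b: "b \<in> X" by blast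
    then have "step\<^sup>* `` {b} = X"
      using X XB(2) below[OF XB(1) b] conn[of b] by (auto simp only: AC_component_def)
    then show "\<exists>b\<in>B. X = step\<^sup>* `` {b}" using b XB by blast
  next
    assume "\<exists>b\<in>B. X = step\<^sup>* `` {b}"
    then obtain b where b: "b \<in> B" and X: "X = step\<^sup>* `` {b}" by blast
    show "AC_component (\<sqinter>) (\<squnion>) A B C X"
      unfolding AC_component_def X
    proof (intro conjI allI impI conn[OF b])
      fix Y assume Y: "AC_connected_set (\<sqinter>) (\<squnion>) A B C Y \<and> step\<^sup>* `` {b} \<subseteq> Y"
      then have "b \<in> Y" by auto
      then show "Y = step\<^sup>* `` {b}" using Y below[of Y b] by (metis subset_antisym)
    qed
  qed
qed

lemma class_triple_on_union: "class_triple (A \<union> B \<union> C) (\<sqinter>) (\<squnion>) A B C"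
proof -
  have sub: "x \<in> S" if "x \<in> A \<union> B \<union> C" for x using that AB.inA AB.inB BC.inB by blast
  have sl: "skew_lattice (A \<union> B \<union> C) (\<sqinter>) (\<squnion>)"
    by unfold_locales
      (auto simp: sub AB.meet_A AB.meet_B BC.meet_B AB.meet_AB AB.meet_BA AC.meet_AB AC.meet_BA
        BC.meet_AB BC.meet_BA AB.join_A AB.join_B BC.join_B AB.join_AB AB.join_BA AC.join_AB
        AC.join_BA BC.join_AB BC.join_BA meet_assoc join_assoc meet_idem join_idem
        meet_join_absorb join_meet_absorb_right join_meet_absorb meet_join_absorb_right)
  have "class_pair_axioms (A \<union> B \<union> C) (\<sqinter>) (\<squnion>) A B"
    using AB.class_pair_axioms by (auto simp: class_pair_def class_pair_axioms_def)
  moreover have "class_pair_axioms (A \<union> B \<union> C) (\<sqinter>) (\<squnion>) B C"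
    using BC.class_pair_axioms by (auto simp: class_pair_def class_pair_axioms_def)
  moreover have "class_pair_axioms (A \<union> B \<union> C) (\<sqinter>) (\<squnion>) A C"
    using AC.class_pair_axioms by (auto simp: class_pair_def class_pair_axioms_def)
  ultimately show ?thesis
    using sl by (simp add: class_triple_def class_pair_def)
qed

text \<open>
  A component is a subalgebra, being a class of a congruence on an idempotent algebra. It is closed
  under the action of \<open>A\<close> by meets and of \<open>C\<close> by joins, because these stay within one coset.
\<close>

lemma class_triple_component:
  assumes "AC_component (\<sqinter>) (\<squnion>) A B C X"
  shows "class_triple S (\<sqinter>) (\<squnion>) A X C"
proof -
  obtain b where b: "b \<in> B" and X: "X = step\<^sup>* `` {b}" using assms AC_component_iff by blast
  have bX: "b \<in> X" by (simp add: X)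
  have XB: "x \<in> B" if "x \<in> X" for x
    using that X by (auto intro: step_rtrancl_closed[OF _ b])
  have meetX: "x \<sqinter> y \<in> X" if "x \<in> X" "y \<in> X" for x y
  proof -
    have bx: "(b, x) \<in> step\<^sup>*" and "(b, y) \<in> step\<^sup>*" using that X by auto
    then have "(x, y) \<in> step\<^sup>*" by (meson step_rtrancl_sym rtrancl_trans)
    then have "(x \<sqinter> x, x \<sqinter> y) \<in> step\<^sup>*" using XB[OF that(1)] by (rule step_rtrancl_meet(2))
    moreover have "x \<sqinter> x = x" using XB[OF that(1)] by (simp add: AB.inB meet_idem)
    ultimately show ?thesis using bx X by auto
  qed
  have stepX: "y \<in> X" if "x \<in> X" "(x, y) \<in> step" for x y
    using that X by (meson Image_singleton_iff rtrancl.rtrancl_into_rtrancl)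
  have joinX: "x \<squnion> y \<in> X" if "x \<in> X" "y \<in> X" for x y
    using that XB meetX by (simp add: AB.join_eq_flipped_meet_B)
  have A_meet: "a \<sqinter> x \<in> X" "x \<sqinter> a \<in> X" if a: "a \<in> A" and x: "x \<in> X" for a x
  proof -
    have xB: "x \<in> B" using x XB by blast
    have r: "a \<sqinter> (a \<sqinter> x) \<sqinter> a = a \<sqinter> x \<sqinter> a" "a \<sqinter> (x \<sqinter> a) \<sqinter> a = a \<sqinter> x \<sqinter> a"
      using a xB by (simp_all add: meet_assoc meet_closed meet_idem meet_left_idem AB.inA AB.inB)
    then have "a \<sqinter> x \<in> meet_coset (\<sqinter>) A x" "x \<sqinter> a \<in> meet_coset (\<sqinter>) A x"
      using AB.meet_coset_iff[OF a xB] a xB by (simp_all add: AB.meet_AB AB.meet_BA)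
    then show "a \<sqinter> x \<in> X" "x \<sqinter> a \<in> X" using stepX x xB step_iff by blast+
  qed
  have C_join: "c \<squnion> x \<in> X" "x \<squnion> c \<in> X" if c: "c \<in> C" and x: "x \<in> X" for c x
  proof -
    interpret dual: skew_lattice S "(\<squnion>)" "(\<sqinter>)" by (rule dual)
    have xB: "x \<in> B" using x XB by blast
    have r: "c \<squnion> (c \<squnion> x) \<squnion> c = c \<squnion> x \<squnion> c" "c \<squnion> (x \<squnion> c) \<squnion> c = c \<squnion> x \<squnion> c"
      using c xB
      by (simp_all add: join_assoc join_closed join_idem dual.meet_left_idem BC.inB AB.inB)
    then have "c \<squnion> x \<in> join_coset (\<squnion>) C x" "x \<squnion> c \<in> join_coset (\<squnion>) C x"
      using BC.join_coset_iff[OF c xB] c xB by (simp_all add: BC.join_AB BC.join_BA)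
    then show "c \<squnion> x \<in> X" "x \<squnion> c \<in> X" using stepX x xB step_iff by blast+
  qed
  have "class_pair S (\<sqinter>) (\<squnion>) A X"
    by unfold_locales
      (use bX XB AB.A_sub AB.B_sub AB.A_ne AB.disjoint in \<open>auto simp: meetX joinX A_meet
        AB.meet_A AB.join_A AB.rect_A AB.rect_B AB.join_AB AB.join_BA AB.B_below_A\<close>)
  moreover have "class_pair S (\<sqinter>) (\<squnion>) X C"
    by unfold_locales
      (use bX XB BC.A_sub BC.B_sub BC.B_ne BC.disjoint in \<open>auto simp: meetX joinX C_join
        BC.meet_B BC.join_B BC.rect_A BC.rect_B BC.meet_AB BC.meet_BA BC.B_below_A\<close>)
  ultimately show ?thesis
    by (simp add: class_triple_def skew_lattice_axioms AC.class_pair_axioms)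
qed

text \<open>
  Under the median law, the map \<open>m\<close> that moves \<open>b\<close> between \<open>a\<close> and \<open>c\<close> takes the same value at
  elements of a common \<open>A\<close>-coset and at elements of a common \<open>C\<close>-coset, hence is constant on
  components, and it fixes midpoints.
\<close>

lemma median_law_iff_unique_midpoints:
  "median_law \<longleftrightarrow>
    (\<forall>X. AC_component (\<sqinter>) (\<squnion>) A B C X \<longrightarrow> class_triple.unique_midpoints (\<sqinter>) A X C)"
proof
  assume ml: median_law
  show "\<forall>X. AC_component (\<sqinter>) (\<squnion>) A B C X \<longrightarrow> class_triple.unique_midpoints (\<sqinter>) A X C"
  proof (intro allI impI)
    fix X assume X: "AC_component (\<sqinter>) (\<squnion>) A B C X"
    interpret X: class_triple S "(\<sqinter>)" "(\<squnion>)" A X C using X by (rule class_triple_component)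
    obtain b0 where b0: "b0 \<in> B" and X_eq: "X = step\<^sup>* `` {b0}" using X AC_component_iff by blast
    show "X.unique_midpoints"
      unfolding X.unique_midpoints_def
    proof (intro ballI impI ex_ex1I)
      fix a c assume a: "a \<in> A" and c: "c \<in> C" and ac: "natural_ge (\<sqinter>) a c"
      show "\<exists>b. midpoint (\<sqinter>) X a c b"
        using X.midpoint_meet[OF a _ c ac] X.AB.B_ne by blast
      define m where "m b = a \<sqinter> (c \<squnion> b \<squnion> c) \<sqinter> a" for b
      have m_eq: "m b = c \<squnion> (a \<sqinter> b \<sqinter> a) \<squnion> c" if "b \<in> B" for b
        using ml a c ac that unfolding median_law_def m_def by blast
      have "m b = m b'" if "(b, b') \<in> step" for b b'
        using that m_eq[of b] m_eq[of b'] AB.meet_coset_iff[OF a] BC.join_coset_iff[OF c]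
        by (auto simp: step_iff m_def)
      then have m_const: "m b = m b0" if "b \<in> X" for b
        using that unfolding X_eq by (auto elim!: rtrancl_induct)
      have m_fix: "m b = b" if "midpoint (\<sqinter>) X a c b" for b
      proof -
        have b: "b \<in> X" "natural_ge (\<sqinter>) a b" "natural_ge (\<sqinter>) b c"
          using that X.midpoint_iff[OF a c] by auto
        then have "c \<squnion> b \<squnion> c = b" "a \<sqinter> b \<sqinter> a = b"
          using X.AB.natural_ge_iff[OF a b(1)] X.BC.natural_ge_iff_join[OF b(1) c] by auto
        then show ?thesis by (simp only: m_def)
      qed
      fix b b' assume "midpoint (\<sqinter>) X a c b" "midpoint (\<sqinter>) X a c b'"
      then show "b = b'" using m_fix m_const by (metis midpoint_def)
    qed
  qed
next
  assume um: "\<forall>X. AC_component (\<sqinter>) (\<squnion>) A B C X \<longrightarrow> class_triple.unique_midpoints (\<sqinter>) A X C"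
  show median_law
    unfolding median_law_def
  proof (intro ballI impI)
    fix a b c assume a: "a \<in> A" and b: "b \<in> B" and c: "c \<in> C" and ac: "natural_ge (\<sqinter>) a c"
    define X where "X = step\<^sup>* `` {b}"
    have X: "AC_component (\<sqinter>) (\<squnion>) A B C X" using b AC_component_iff X_def by blast
    interpret X: class_triple S "(\<sqinter>)" "(\<squnion>)" A X C using X by (rule class_triple_component)
    have bX: "b \<in> X" by (simp add: X_def)
    have "X.unique_midpoints" using um X by simp
    then have "\<exists>!b. midpoint (\<sqinter>) X a c b"
      using a c ac by (simp add: X.unique_midpoints_def)
    then show "a \<sqinter> (c \<squnion> b \<squnion> c) \<sqinter> a = c \<squnion> (a \<sqinter> b \<sqinter> a) \<squnion> c"
      using X.midpoint_meet[OF a bX c ac] X.midpoint_join[OF a bX c ac] by auto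
  qed
qed

end

section \<open>Skew chains\<close>

context skew_lattice
begin

lemma D_rel_iff:
  "(x, y) \<in> D_rel S (\<squnion>) \<longleftrightarrow> x \<in> S \<and> y \<in> S \<and> x \<sqinter> y \<sqinter> x = x \<and> y \<sqinter> x \<sqinter> y = y"
  by (auto simp: D_rel_def preorder_ge_iff_meet)

lemma D_class_eq:
  assumes "X \<in> D_classes S (\<squnion>)" "x \<in> X"
  shows "X = {y \<in> S. x \<sqinter> y \<sqinter> x = x \<and> y \<sqinter> x \<sqinter> y = y}" and "x \<in> S"
proof -
  obtain x0 where x0: "x0 \<in> S" and X: "X = D_rel S (\<squnion>) `` {x0}"
    using assms(1) by (auto simp: D_classes_def elim: quotientE)
  have x: "x \<in> S" "x0 \<sqinter> x \<sqinter> x0 = x0" "x \<sqinter> x0 \<sqinter> x = x"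
    using assms(2) by (auto simp: X D_rel_iff)
  show "x \<in> S" by fact
  show "X = {y \<in> S. x \<sqinter> y \<sqinter> x = x \<and> y \<sqinter> x \<sqinter> y = y}"
  proof (intro set_eqI iffI)
    fix y assume "y \<in> X"
    then show "y \<in> {y \<in> S. x \<sqinter> y \<sqinter> x = x \<and> y \<sqinter> x \<sqinter> y = y}"
      using meet_absorb_trans[of x x0 y] meet_absorb_trans[of y x0 x] x x0
      by (auto simp: X D_rel_iff)
  next
    fix y assume "y \<in> {y \<in> S. x \<sqinter> y \<sqinter> x = x \<and> y \<sqinter> x \<sqinter> y = y}"
    then show "y \<in> X"
      using meet_absorb_trans[of x0 x y] meet_absorb_trans[of y x x0] x x0
      by (auto simp: X D_rel_iff)
  qed
qed

lemma meet_in_D_class: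
  assumes X: "X \<in> D_classes S (\<squnion>)" and x: "x \<in> X" and y: "y \<in> S" and xyx: "x \<sqinter> y \<sqinter> x = x"
  shows "x \<sqinter> y \<in> X" and "y \<sqinter> x \<in> X"
proof -
  note S [simp] = D_class_eq(2)[OF X x] y meet_closed meet_assoc
  show "x \<sqinter> y \<in> X" "y \<sqinter> x \<in> X"
    unfolding D_class_eq(1)[OF X x]
    using xyx by (simp_all add: meet_left_idem meet_absorb_left meet_idem)
qed

text \<open>
  The dual of the preceding lemma, once the \<open>\<D>\<close>-class is described by joins.
\<close>

lemma join_in_D_class:
  assumes X: "X \<in> D_classes S (\<squnion>)" and x: "x \<in> X" and y: "y \<in> S" and yxy: "y \<sqinter> x \<sqinter> y = y"
  shows "x \<squnion> y \<in> X" and "y \<squnion> x \<in> X"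
proof -
  interpret dual: skew_lattice S "(\<squnion>)" "(\<sqinter>)" by (rule dual)
  note S [simp] = D_class_eq(2)[OF X x] y join_closed join_assoc
  have xyx: "x \<squnion> (y \<squnion> x) = x"
    using yxy join_absorb_iff_meet_absorb[of x y] by simp
  have "X = {z \<in> S. x \<squnion> z \<squnion> x = x \<and> z \<squnion> x \<squnion> z = z}"
    unfolding D_class_eq(1)[OF X x] by (auto simp: join_absorb_iff_meet_absorb simp del: join_assoc)
  then show "x \<squnion> y \<in> X" "y \<squnion> x \<in> X"
    using xyx by (simp_all add: dual.meet_left_idem dual.meet_absorb_left join_idem)
qed

lemma class_pair_D_classes:
  assumes X: "X \<in> D_classes S (\<squnion>)" and Y: "Y \<in> D_classes S (\<squnion>)" and gt: "class_gt (\<squnion>) X Y"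
  shows "class_pair S (\<sqinter>) (\<squnion>) X Y"
proof -
  have ne: "Z \<noteq> {}" if "Z \<in> D_classes S (\<squnion>)" for Z
    using that meet_idem by (fastforce simp: D_classes_def D_rel_iff elim!: quotientE)
  note XS = D_class_eq(2)[OF X] and YS = D_class_eq(2)[OF Y]
  have rect: "x \<sqinter> y \<sqinter> x = x" if "Z \<in> D_classes S (\<squnion>)" "x \<in> Z" "y \<in> Z" for x y Z
    using D_class_eq(1)[OF that(1,2)] that(3) by blast
  have below: "y \<sqinter> x \<sqinter> y = y" if "x \<in> X" "y \<in> Y" for x y
    using gt that XS YS by (simp add: class_gt_def preorder_ge_iff_meet)
  have "X = Y" if "z \<in> X" "z \<in> Y" for z
    unfolding D_class_eq(1)[OF X that(1)] D_class_eq(1)[OF Y that(2)] ..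
  then have "X \<inter> Y = {}" using gt by (auto simp: class_gt_def)
  then show ?thesis
    by unfold_locales
      (auto simp: XS YS ne[OF X] ne[OF Y] rect[OF X] rect[OF Y] below
        meet_in_D_class[OF X] meet_in_D_class[OF Y] join_in_D_class[OF X] join_in_D_class[OF Y])
qed

end

lemma class_triple_if_skew_chain:
  assumes "skew_chain A B C meet join"
  shows "class_triple (A \<union> B \<union> C) meet join A B C"
proof -
  interpret skew_chain A B C meet join by fact
  have D: "A \<in> D_classes (A \<union> B \<union> C) join" "B \<in> D_classes (A \<union> B \<union> C) join"
    "C \<in> D_classes (A \<union> B \<union> C) join"
    using classes by auto
  interpret AB: class_pair "A \<union> B \<union> C" meet join A B
    by (rule class_pair_D_classes[OF D(1,2) A_gt_B])
  interpret BC: class_pair "A \<union> B \<union> C" meet join B C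
    by (rule class_pair_D_classes[OF D(2,3) B_gt_C])
  have below: "meet (meet c a) c = c" if "a \<in> A" "c \<in> C" for a c
  proof -
    obtain b where b: "b \<in> B" using AB.B_ne by blast
    show ?thesis
      using meet_absorb_trans[of c b a] that b AB.inA AB.inB BC.inB BC.B_below_A AB.B_below_A
      by blast
  qed
  have "A \<noteq> C"
  proof
    assume "A = C"
    obtain a b where a: "a \<in> A" and b: "b \<in> B" using AB.A_ne AB.B_ne by blast
    have "meet (meet b a) b = b" using AB.B_below_A a b by blast
    moreover have "meet (meet a b) a = a" using BC.B_below_A a b \<open>A = C\<close> by blast
    ultimately have "b \<in> A"
      using b by (subst D_class_eq(1)[OF D(1) a]) simp
    then show False using b AB.disjoint by blast
  qed
  then have "class_gt join A C"
    using below AB.inA BC.inB by (simp add: class_gt_def preorder_ge_iff_meet)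
  then have "class_pair (A \<union> B \<union> C) meet join A C"
    by (rule class_pair_D_classes[OF D(1,3)])
  then show ?thesis
    by (simp add: class_triple_def AB.class_pair_axioms BC.class_pair_axioms skew_lattice_axioms)
qed

context class_pair
begin

lemma preorder_ge_upper: "\<lbrakk>a \<in> A; a' \<in> A\<rbrakk> \<Longrightarrow> preorder_ge (\<squnion>) a a'"
  by (simp add: preorder_ge_def join_rect_A)

lemma preorder_ge_lower: "\<lbrakk>b \<in> B; b' \<in> B\<rbrakk> \<Longrightarrow> preorder_ge (\<squnion>) b b'"
  by (simp add: preorder_ge_def join_rect_B)

lemma preorder_ge_upper_lower: "\<lbrakk>a \<in> A; b \<in> B\<rbrakk> \<Longrightarrow> preorder_ge (\<squnion>) a b"
  by (simp add: preorder_ge_def A_above_B)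

lemma not_preorder_ge_lower_upper:
  assumes "a \<in> A" "b \<in> B"
  shows "\<not> preorder_ge (\<squnion>) b a"
proof
  assume "preorder_ge (\<squnion>) b a"
  moreover have "b \<squnion> a \<squnion> b \<in> A" using assms by (simp add: join_AB join_BA)
  ultimately show False using assms disjoint by (auto simp: preorder_ge_def)
qed

lemma not_class_gt_lower_upper: "\<not> class_gt (\<squnion>) B A"
  using not_preorder_ge_lower_upper A_ne B_ne by (auto simp: class_gt_def)

lemma class_gt_upper_lower: "class_gt (\<squnion>) A B"
  using preorder_ge_upper_lower A_ne disjoint by (auto simp: class_gt_def)

end

context class_triple
begin

lemma D_classes_eq:
  assumes S: "S = A \<union> B \<union> C"
  shows "D_classes S (\<squnion>) = {A, B, C}"
proof -
  note rules = AB.preorder_ge_upper AB.preorder_ge_lower BC.preorder_ge_lower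
    AB.not_preorder_ge_lower_upper BC.not_preorder_ge_lower_upper AC.not_preorder_ge_lower_upper
  have A: "D_rel S (\<squnion>) `` {a} = A" if "a \<in> A" for a
    using that rules by (auto simp: D_rel_def S)
  have B: "D_rel S (\<squnion>) `` {b} = B" if "b \<in> B" for b
    using that rules by (auto simp: D_rel_def S)
  have C: "D_rel S (\<squnion>) `` {c} = C" if "c \<in> C" for c
    using that rules by (auto simp: D_rel_def S)
  have "D_classes S (\<squnion>) = (\<lambda>x. D_rel S (\<squnion>) `` {x}) ` (A \<union> B \<union> C)"
    unfolding D_classes_def quotient_def S by blast
  also have "\<dots> = (\<lambda>_. A) ` A \<union> (\<lambda>_. B) ` B \<union> (\<lambda>_. C) ` C"
    using A B C by (simp add: image_Un)
  also have "\<dots> = {A, B, C}"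
    using AB.A_ne BC.A_ne BC.B_ne by auto
  finally show ?thesis .
qed

text \<open>
  The definition of strict categoricity ranges over all descending triples of \<open>\<D>\<close>-classes; in a chain
  of three classes there is only one.
\<close>

lemma descending_classes:
  assumes "X \<in> {A, B, C}" "Y \<in> {A, B, C}" "Z \<in> {A, B, C}" "class_gt (\<squnion>) X Y" "class_gt (\<squnion>) Y Z"
  shows "X = A \<and> Y = B \<and> Z = C"
proof -
  have irrefl: "\<not> class_gt (\<squnion>) W W" for W by (simp add: class_gt_def)
  show ?thesis
    using assms irrefl AB.not_class_gt_lower_upper BC.not_class_gt_lower_upper
      AC.not_class_gt_lower_upper by auto
qed

lemma strictly_categorical_iff:
  assumes S: "S = A \<union> B \<union> C"
  shows "strictly_categorical_skew_lattice S (\<sqinter>) (\<squnion>) \<longleftrightarrow> unique_midpoints"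
proof
  assume "strictly_categorical_skew_lattice S (\<sqinter>) (\<squnion>)"
  then interpret sc: strictly_categorical_skew_lattice S "(\<sqinter>)" "(\<squnion>)" .
  have "A \<in> D_classes S (\<squnion>)" "B \<in> D_classes S (\<squnion>)" "C \<in> D_classes S (\<squnion>)"
    by (simp_all add: D_classes_eq[OF S])
  note 1 = this AB.class_gt_upper_lower BC.class_gt_upper_lower
  have composites_are_coset_bijections
    unfolding composites_are_coset_bijections_def using sc.comp_coset_bijection[OF 1] by blast
  moreover have cosets_intersect
    unfolding cosets_intersect_def using sc.cosets_meet[OF 1]
    by (simp add: meet_cosets_def join_cosets_def)
  ultimately show unique_midpoints by (simp add: unique_midpoints_iff)
next
  assume unique_midpoints
  then have comp: composites_are_coset_bijections and inter: cosets_intersect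
    by (simp_all add: unique_midpoints_iff)
  show "strictly_categorical_skew_lattice S (\<sqinter>) (\<squnion>)"
  proof unfold_locales
    fix X Y Z \<phi> \<psi>
    assume *: "X \<in> D_classes S (\<squnion>)" "Y \<in> D_classes S (\<squnion>)" "Z \<in> D_classes S (\<squnion>)"
      "class_gt (\<squnion>) X Y" "class_gt (\<squnion>) Y Z"
    then have XYZ: "X = A" "Y = B" "Z = C"
      using descending_classes unfolding D_classes_eq[OF S] by blast+
    { assume "coset_bijection (\<sqinter>) (\<squnion>) X Y \<phi>" "coset_bijection (\<sqinter>) (\<squnion>) Y Z \<psi>"
        "\<psi> \<circ>\<^sub>m \<phi> \<noteq> Map.empty"
      then show "coset_bijection (\<sqinter>) (\<squnion>) X Z (\<psi> \<circ>\<^sub>m \<phi>)"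
        using comp unfolding XYZ composites_are_coset_bijections_def by blast }
    { fix P Q assume "P \<in> meet_cosets (\<sqinter>) X Y" "Q \<in> join_cosets (\<squnion>) Z Y"
      then show "P \<inter> Q \<noteq> {}"
        using inter unfolding XYZ cosets_intersect_def meet_cosets_def join_cosets_def by blast }
  qed
qed

end

theorem theorem4p6:
  fixes A B C :: "'a set"
    and meet :: "'a \<Rightarrow> 'a \<Rightarrow> 'a" (infixl "\<sqinter>" 70)
    and join :: "'a \<Rightarrow> 'a \<Rightarrow> 'a" (infixl "\<squnion>" 65)
  assumes chain: "skew_chain A B C meet join"
  defines "cond_i \<equiv> distributive_skew_lattice (A \<union> B \<union> C) meet join"
    and "cond_ii \<equiv> (\<forall>a\<in>A. \<forall>b\<in>B. \<forall>c\<in>C. natural_gt meet a c \<longrightarrow>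
           a \<sqinter> (c \<squnion> b \<squnion> c) \<sqinter> a = c \<squnion> (a \<sqinter> b \<sqinter> a) \<squnion> c)"
    and "cond_iii \<equiv> (\<forall>a\<in>A. \<forall>c\<in>C. natural_gt meet a c \<longrightarrow>
           (\<forall>B'. AC_component meet join A B C B' \<longrightarrow>
             (\<exists>!b. b \<in> B' \<and> midpoint meet B a c b)))"
    and "cond_iv \<equiv> (\<forall>B'. AC_component meet join A B C B' \<longrightarrow>
           strictly_categorical_skew_lattice (A \<union> B' \<union> C) meet join)"
  shows "(cond_i \<longleftrightarrow> cond_ii) \<and> (cond_i \<longleftrightarrow> cond_iii) \<and> (cond_i \<longleftrightarrow> cond_iv) \<and>
    (cond_i \<longrightarrow>
      (\<forall>\<chi>. coset_bijection meet join A C \<chi> \<longrightarrow>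
        (\<forall>B'. AC_component meet join A B C B' \<longrightarrow>
          (\<exists>!(\<phi>, \<psi>). coset_bijection meet join A B' \<phi> \<and> coset_bijection meet join B' C \<psi> \<and>
             \<chi> = \<psi> \<circ>\<^sub>m \<phi>))))"
proof -
  interpret class_triple "A \<union> B \<union> C" meet join A B C
    using chain by (rule class_triple_if_skew_chain)
  have quantifier_swap: "(\<forall>X. K X \<longrightarrow> (\<forall>a\<in>A. \<forall>c\<in>C. G a c \<longrightarrow> Q X a c)) \<longleftrightarrow>
      (\<forall>a\<in>A. \<forall>c\<in>C. G a c \<longrightarrow> (\<forall>X. K X \<longrightarrow> Q X a c))" for K G Q
    by blast
  let ?comp = "AC_component meet join A B C"
  let ?um = "\<lambda>X. class_triple.unique_midpoints meet A X C"
  have triple: "class_triple (A \<union> X \<union> C) meet join A X C" if "?comp X" for X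
    using class_triple_component[OF that] by (rule class_triple.class_triple_on_union)
  have "X \<subseteq> B" if "?comp X" for X
    using that by (simp add: AC_component_def AC_connected_set_def)
  then have mid: "(\<exists>!b. b \<in> X \<and> midpoint meet B a c b) \<longleftrightarrow> (\<exists>!b. midpoint meet X a c b)"
    if "?comp X" for X a c
    using that by (intro arg_cong[where f = Ex1] ext) (auto simp: midpoint_def)
  have i_ii: "cond_i \<longleftrightarrow> cond_ii"
    unfolding cond_i_def cond_ii_def distributive_iff_median_law[OF refl] median_law_def
    by (simp add: AC.natural_gt_iff)
  have i_um: "cond_i \<longleftrightarrow> (\<forall>X. ?comp X \<longrightarrow> ?um X)"
    unfolding cond_i_def distributive_iff_median_law[OF refl]
    by (rule median_law_iff_unique_midpoints)
  have "?um X \<longleftrightarrow> (\<forall>a\<in>A. \<forall>c\<in>C. natural_gt meet a c \<longrightarrow>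
      (\<exists>!b. b \<in> X \<and> midpoint meet B a c b))" if X: "?comp X" for X
    by (simp add: class_triple.unique_midpoints_def[OF triple[OF X]] mid[OF X] AC.natural_gt_iff)
  then have "cond_i \<longleftrightarrow> (\<forall>X. ?comp X \<longrightarrow> (\<forall>a\<in>A. \<forall>c\<in>C. natural_gt meet a c \<longrightarrow>
      (\<exists>!b. b \<in> X \<and> midpoint meet B a c b)))"
    by (simp add: i_um)
  also have "\<dots> \<longleftrightarrow> cond_iii"
    unfolding cond_iii_def by (rule quantifier_swap)
  finally have i_iii: "cond_i \<longleftrightarrow> cond_iii" .
  have i_iv: "cond_i \<longleftrightarrow> cond_iv"
    unfolding i_um cond_iv_def
    by (simp add: class_triple.strictly_categorical_iff[OF triple refl])
  show ?thesis
  proof (intro conjI impI allI)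
    show "cond_i \<longleftrightarrow> cond_ii" "cond_i \<longleftrightarrow> cond_iii" "cond_i \<longleftrightarrow> cond_iv"
      by (fact i_ii i_iii i_iv)+
    fix \<chi> X assume cond_i and \<chi>: "coset_bijection meet join A C \<chi>" and X: "?comp X"
    then have "?um X" using i_um by simp
    then show "\<exists>!(\<phi>, \<psi>). coset_bijection meet join A X \<phi> \<and>
        coset_bijection meet join X C \<psi> \<and> \<chi> = \<psi> \<circ>\<^sub>m \<phi>"
      using \<chi> by (rule class_triple.unique_factorization[OF triple[OF X]])
  qed
qed

end
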